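(* Let $x\in(0,1)$ and $\mu,\nu\in\mathbb{C}$. The following two pairs of (mutually inverse) relations hold. First pair: $$\frac{P_\nu^{-\mu}\left(\frac1x\right)}{\sqrt\pi\,2^{\nu-\mu}x^{-\nu}}=\sum_{n=0}^\infty\frac{(\mu-\nu)_n\,\mathcal{G}_n\left(\nu,\nu,\sqrt{\frac{1-x}{1+x}}\right)}{2^n\,\Gamma\left(\frac{n+\mu-\nu+1}{2}\right)}\left(\frac{1-x}{1+x}\right)^{\frac{n+\mu-\nu}{4}}P_\nu^{-\frac{\mu+\nu+n}{2}}(x),$$ and, if $\operatorname{Re}\nu>-1$ or $\nu-\mu\in\mathbb{N}_0$, $$\left(\frac{1-x}{1+x}\right)^{\frac{\mu-\nu}{4}}\frac{P_\nu^{-\frac{\mu+\nu}{2}}(x)}{\Gamma\left(\frac{\mu-\nu+1}{2}\right)}=\sum_{n=0}^\infty\frac{(\mu-\nu)_n\,\mathcal{G}_n\left(-\nu,-\nu,\sqrt{\frac{1-x}{1+x}}\right)}{\sqrt\pi\,2^{\nu-\mu}x^{-\nu}}P_\nu^{-\mu-n}\!\left(\frac1x\right).$$ Second pair: $$\frac{P_\nu^{-\mu}(x)}{\sqrt\pi\,2^{\nu-\mu}x^{\nu}}=\sum_{n=0}^\infty\frac{(\mu-\nu)_n\,\widehat{\mathcal{G}}_n\left(\nu,\nu,\sqrt{\frac{1-x}{1+x}}\right)}{2^n\,\Gamma\left(\frac{n+\mu-\nu+1}{2}\right)}\left(\frac{1-x}{1+x}\right)^{\frac{n+\mu-\nu}{4}}P_\nu^{-\frac{\mu+\nu+n}{2}}\!\left(\frac1x\right),$$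 and, if $\operatorname{Re}\nu>-1$ or $\nu-\mu\in\mathbb{N}_0$, $$\left(\frac{1-x}{1+x}\right)^{\frac{\mu-\nu}{4}}\frac{P_\nu^{-\frac{\mu+\nu}{2}}\left(\frac1x\right)}{\Gamma\left(\frac{\mu-\nu+1}{2}\right)}=\sum_{n=0}^\infty\frac{(\mu-\nu)_n\,\widehat{\mathcal{G}}_n\left(-\nu,-\nu,\sqrt{\frac{1-x}{1+x}}\right)}{\sqrt\pi\,2^{\nu-\mu}x^{\nu}}P_\nu^{-\mu-n}(x).$$
   Context: $\mathbb{N}_0=\{0,1,2,\dots\}$; $(a)_n=a(a+1)\cdots(a+n-1)$, $(a)_0=1$; $1/\Gamma$ is the entire reciprocal gamma function. The functions $\mathcal{G}_n(\tau,\rho,w)$ and $\widehat{\mathcal{G}}_n(\tau,\rho,\eta)$ are the Maclaurin coefficients $$(1-wz)^{\tau}\left(1+\frac zw\right)^{-\tau}(1+z^2)^{-\rho}=\sum_{n=0}^\infty\mathcal{G}_n(\tau,\rho,w)z^n,$$ $$(1+\eta\zeta)^{\tau}\left(1+\frac\zeta\eta\right)^{-\tau}(1-\zeta^2)^{-\rho}=\sum_{n=0}^\infty\widehat{\mathcal{G}}_n(\tau,\rho,\eta)\zeta^n,$$ for small $|z|,|\zeta|$, each factor being $1$ at $0$. For $\mu,\nu\in\mathbb{C}$ and real $x>-1$, $x\ne1$, $$P_\nu^{-\mu}(x)=\left|\frac{1-x}{1+x}\right|^{\mu/2}\frac{F\left(-\nu,\nu+1;1+\mu;\frac{1-x}{2}\right)}{\Gamma(1+\mu)},$$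 where $F(a,b;c;t)$ is the Gauss hypergeometric function (analytically continued to $t\le-1$), and $F(a,b;c;t)/\Gamma(c)$ is understood as the regularized function, entire in $a,b,c$. For $|x|<1$ this is the Ferrers function, for $x>1$ the associated Legendre function of the first kind. *)

theory Defs
  imports "HOL-Complex_Analysis.Complex_Analysis"
begin

text \<open>
  The power series of the regularized Gauss function F(a,b;c;t) / Gamma(c), using
  Gamma(c) (c)_n = Gamma(c+n). With the entire reciprocal Gamma function \<^const>\<open>rGamma\<close>
  the coefficients make sense for all complex a, b, c.
\<close>

definition hyp2F1_reg_fps :: "complex \<Rightarrow> complex \<Rightarrow> complex \<Rightarrow> complex fps" where
  "hyp2F1_reg_fps a b c =
     Abs_fps (\<lambda>n. pochhammer a n * pochhammer b n * rGamma (c + of_nat n) / fact n)"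

text \<open>
  The value at t of the analytic continuation of this series along the segment from 0 to t,
  i.e. the principal branch, for t off the cut [1,\<infinity>). Uniqueness of the value is
  \<open>hyp2F1_reg_eqI\<close> below.
\<close>

definition hyp2F1_reg :: "complex \<Rightarrow> complex \<Rightarrow> complex \<Rightarrow> complex \<Rightarrow> complex" where
  "hyp2F1_reg a b c t =
     (THE v. \<exists>f S. open S \<and> t \<in> S \<and> (\<forall>z\<in>S. closed_segment 0 z \<subseteq> S) \<and>
        f holomorphic_on S \<and> f has_fps_expansion hyp2F1_reg_fps a b c \<and> f t = v)"

lemma hyp2F1_reg_eqI:
  assumes f: "open S" "t \<in> S" "\<And>z. z \<in> S \<Longrightarrow> closed_segment 0 z \<subseteq> S"
    "f holomorphic_on S" "f has_fps_expansion hyp2F1_reg_fps a b c"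
  shows "hyp2F1_reg a b c t = f t"
  unfolding hyp2F1_reg_def
proof (rule the_equality)
  show "\<exists>g S. open S \<and> t \<in> S \<and> (\<forall>z\<in>S. closed_segment 0 z \<subseteq> S) \<and>
      g holomorphic_on S \<and> g has_fps_expansion hyp2F1_reg_fps a b c \<and> g t = f t"
    using f by blast
next
  fix v
  assume "\<exists>g S. open S \<and> t \<in> S \<and> (\<forall>z\<in>S. closed_segment 0 z \<subseteq> S) \<and>
      g holomorphic_on S \<and> g has_fps_expansion hyp2F1_reg_fps a b c \<and> g t = v"
  then obtain g T where g: "open T" "t \<in> T" "\<forall>z\<in>T. closed_segment 0 z \<subseteq> T"
    "g holomorphic_on T" "g has_fps_expansion hyp2F1_reg_fps a b c" "g t = v"
    by blast
  have "0 \<in> S \<inter> T"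
    using f(2,3) g(2,3) by (meson IntI ends_in_segment(1) subsetD)
  moreover have "closed_segment 0 z \<subseteq> S \<inter> T" if "z \<in> S \<inter> T" for z
    using that f(3) g(3) by blast
  ultimately have "starlike (S \<inter> T)"
    unfolding starlike_def by blast
  hence conn: "connected (S \<inter> T)"
    by (rule starlike_imp_connected)
  have "\<forall>\<^sub>F z in nhds 0. f z = g z"
    using f(5) g(5) unfolding has_fps_expansion_def
    by (auto elim: eventually_elim2)
  then obtain U where U: "open U" "0 \<in> U" "\<And>z. z \<in> U \<Longrightarrow> f z = g z"
    unfolding eventually_nhds by blast
  have "f t - g t = 0"
  proof (rule analytic_continuation_open[of "U \<inter> (S \<inter> T)" "S \<inter> T" "\<lambda>z. f z - g z" "\<lambda>_. 0" t])
    show "U \<inter> (S \<inter> T) \<noteq> {}"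
      using \<open>0 \<in> S \<inter> T\<close> U(2) by blast
    show "(\<lambda>z. f z - g z) holomorphic_on S \<inter> T"
      by (intro holomorphic_intros holomorphic_on_subset[OF f(4)] holomorphic_on_subset[OF g(4)]) auto
  qed (use f g U conn in auto)
  thus "v = f t"
    using g(6) by simp
qed

text \<open>
  \<open>legendreP \<nu> m x\<close> is the function usually written P with lower index \<nu> and upper index m:
  the Ferrers function for \<bar>x\<bar> < 1, the associated Legendre function of the first kind for x > 1.
\<close>

definition legendreP :: "complex \<Rightarrow> complex \<Rightarrow> real \<Rightarrow> complex" where
  "legendreP \<nu> m x =
     complex_of_real \<bar>(1 - x) / (1 + x)\<bar> powr (- m / 2) *
     hyp2F1_reg (- \<nu>) (\<nu> + 1) (1 - m) (complex_of_real ((1 - x) / 2))"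

text \<open>
  Principal powers are holomorphic near base 1 and take the value 1 there, so they are the
  required branches. Both definitions are meaningful for w, \<eta> \<noteq> 0.
\<close>

definition calG :: "nat \<Rightarrow> complex \<Rightarrow> complex \<Rightarrow> complex \<Rightarrow> complex" where
  "calG n \<tau> \<rho> w =
     fps_nth (fps_expansion
       (\<lambda>z. (1 - w * z) powr \<tau> * (1 + z / w) powr (- \<tau>) * (1 + z\<^sup>2) powr (- \<rho>)) 0) n"

definition calG_hat :: "nat \<Rightarrow> complex \<Rightarrow> complex \<Rightarrow> complex \<Rightarrow> complex" where
  "calG_hat n \<tau> \<rho> \<eta> =
     fps_nth (fps_expansion
       (\<lambda>z. (1 + \<eta> * z) powr \<tau> * (1 + z / \<eta>) powr (- \<tau>) * (1 - z\<^sup>2) powr (- \<rho>)) 0) n"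

end

theory Submission
  imports Defs "HOL-Real_Asymp.Real_Asymp"
begin

text \<open>
  Put \<open>s = \<mu> - \<nu>\<close> and \<open>q = (1 - x) / (1 + x)\<close>, and consider the two functionals
    \<open>B f = 1 / (\<Gamma>(s) \<Gamma>(\<nu>+1)) \<integral>\<^sub>0\<^sup>1 v^(s-1) (1 - v)^\<nu> f(v) dv\<close>  and
    \<open>D f = 1 / (\<Gamma>(s) \<Gamma>(\<nu>+1)) \<integral>\<^sub>0\<^sup>1 v^(s-1) (1 - v\<^sup>2)^\<nu> f(v) dv\<close>.
  By a Pfaff transformation (\<open>legendreP_conv_series\<close>) and Euler's integral, the Legendre function
  of order \<open>-\<mu>\<close> at \<open>1/x\<close> is \<open>B ((1 - q v)^\<nu>)\<close> up to explicit factors, and the Ferrers function of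
  order \<open>-(\<mu>+\<nu>)/2\<close> at \<open>x\<close> is \<open>D ((1 + q v\<^sup>2)^\<nu>)\<close>, by the substitution of \<open>v\<^sup>2\<close> for \<open>v\<close>. The two weights
  differ by the factor \<open>(1 + v)^\<nu>\<close>, so
    \<open>B ((1 - q v)^\<nu>) = D (g(v) (1 + q v\<^sup>2)^\<nu>)\<close>  with  \<open>g(v) = ((1 - q v) / ((1 + v) (1 + q v\<^sup>2)))^\<nu>\<close>.
  Up to the scaling \<open>z = sqrt q v\<close>, \<open>g\<close> is the generating function of the coefficients \<open>calG\<close>, and
  multiplying the integrand by \<open>v^n\<close> replaces \<open>s\<close> by \<open>s + n\<close>, up to a factor \<open>(s)\<^sub>n\<close>. Expanding \<open>g\<close> termwise gives the first
  relation; expanding \<open>1/g\<close> under \<open>B\<close> gives its inverse; exchanging \<open>x\<close> and \<open>1/x\<close> changes \<open>q\<close> to \<open>-q\<close>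
  and gives the second pair.

  The integrals diverge for most parameters, so the proof replaces them by their moments
  \<open>B v^n\<close> and \<open>D v^n\<close> (\<open>beta_moment\<close>, \<open>sq_moment\<close>), which are entire in \<open>s\<close> and \<open>\<nu>\<close>. That the weights
  differ by \<open>(1 + v)^\<nu>\<close> becomes two summation formulas for moments: Kummer's theorem
  \<open>B ((1 + v)^\<nu>) = D 1\<close> (\<open>kummer\<close>) and its inverse \<open>D ((1 + v)^(-\<nu>)) = B 1\<close> (\<open>inverse_kummer\<close>). The
  first follows from contiguous relations, which telescope, and from its limit as \<open>s\<close> tends to
  infinity, where it becomes the binomial theorem for \<open>(1 + 1)^\<nu>\<close>. The second follows from the first
  if \<open>Re \<nu> > 0\<close>, and then for all \<open>\<nu>\<close> by a third contiguous relation.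

  What remains is to reorder double series (\<open>moment_rearrangement\<close>). The factors \<open>(1 - q v)^\<nu>\<close> and
  \<open>(1 + q v\<^sup>2)^\<nu>\<close> have radius of convergence greater than 1 and cause no difficulty. The coefficients
  of \<open>(1 + v)^(-\<nu>)\<close> are of order \<open>n^(\<nu>-1)\<close> and the moments of order \<open>n^(-\<nu>-1)\<close>, so the first relation
  converges absolutely for all parameters. In the inverse relation the coefficients of \<open>(1 + v)^\<nu>\<close>
  behave like \<open>(-1)^n n^(-\<nu>-1)\<close>, and Dirichlet's test needs \<open>Re \<nu> > -1\<close>; if \<open>-s\<close> is a natural
  number, the moments \<open>B v^n\<close> vanish for large \<open>n\<close> and the series is finite.
\<close>

section \<open>Series against decaying moments\<close>

lemma limit_imp_norm_bounded:
  fixes X :: "nat \<Rightarrow> 'a :: real_normed_vector"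
  assumes "X \<longlonglongrightarrow> L"
  shows "\<exists>C. \<forall>n. norm (X n) \<le> C"
proof -
  have "Bseq X"
    using assms by (intro convergent_imp_Bseq convergentI)
  thus ?thesis
    by (auto simp: Bseq_def)
qed

text \<open>
  Dominated convergence for series. The Weierstrass test makes the partial sums converge uniformly
  in the parameter, which allows the two limits to be exchanged.
\<close>

lemma tannery:
  fixes f :: "nat \<Rightarrow> nat \<Rightarrow> 'a :: banach"
  assumes dom: "\<forall>\<^sub>F N in sequentially. \<forall>k. norm (f N k) \<le> M k"
    and M: "summable M"
    and lim: "\<And>k. (\<lambda>N. f N k) \<longlonglongrightarrow> g k"
  shows "summable g" "(\<lambda>N. \<Sum>k. f N k) \<longlonglongrightarrow> (\<Sum>k. g k)"
proof -
  have g: "norm (g k) \<le> M k" for k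
    by (rule tendsto_upperbound[OF tendsto_norm[OF lim]]) (use dom in \<open>auto elim: eventually_mono\<close>)
  show sg: "summable g"
    by (rule summable_comparison_test'[OF M]) (use g in auto)
  obtain N0 where N0: "\<And>N k. N \<ge> N0 \<Longrightarrow> norm (f N k) \<le> M k"
    using dom unfolding eventually_sequentially by blast
  have ul: "uniform_limit {N0..} (\<lambda>n N. \<Sum>i<n. f N i) (\<lambda>N. suminf (f N)) sequentially"
    using Weierstrass_m_test_ev[of "{N0..}" "\<lambda>k N. f N k" M] N0 M by auto
  show "(\<lambda>N. \<Sum>k. f N k) \<longlonglongrightarrow> (\<Sum>k. g k)"
  proof (rule swap_uniform_limit'[OF _ _ ul])
    show "\<forall>\<^sub>F n in sequentially. (\<lambda>N. \<Sum>i<n. f N i) \<longlonglongrightarrow> (\<Sum>i<n. g i)"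
      by (intro always_eventually allI tendsto_intros lim)
    show "(\<lambda>n. \<Sum>i<n. g i) \<longlonglongrightarrow> (\<Sum>k. g k)"
      using sg by (rule summable_LIMSEQ)
    show "\<forall>\<^sub>F x in sequentially. x \<in> {N0..}"
      using eventually_ge_at_top by auto
  qed auto
qed

text \<open>
  Shifting the index by \<open>k\<close> changes a power of \<open>n\<close> by at most a power of \<open>k\<close>, because
  \<open>1 \<le> (n + k + 1) / (n + 1) \<le> k + 1\<close>. Sums against coefficients that decay exponentially absorb
  this loss.
\<close>

lemma powr_shift_le:
  fixes p :: real
  shows "real (Suc (n + k)) powr p \<le> real (Suc n) powr p * real (Suc k) powr \<bar>p\<bar>"
    and "real (Suc n) powr p \<le> real (Suc (n + k)) powr p * real (Suc k) powr \<bar>p\<bar>"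
proof -
  define t where "t = real (Suc (n + k)) / real (Suc n)"
  have t: "1 \<le> t" "t \<le> real (Suc k)"
    unfolding t_def by (auto simp: field_simps)
  have le: "t powr q \<le> real (Suc k) powr \<bar>q\<bar>" for q
  proof -
    have "t powr q \<le> t powr \<bar>q\<bar>"
      using t by (intro powr_mono) auto
    also have "\<dots> \<le> real (Suc k) powr \<bar>q\<bar>"
      using t by (intro powr_mono2) auto
    finally show ?thesis .
  qed
  have eq: "real (Suc (n + k)) = real (Suc n) * t"
    unfolding t_def by simp
  show "real (Suc (n + k)) powr p \<le> real (Suc n) powr p * real (Suc k) powr \<bar>p\<bar>"
    unfolding eq using le[of p] t by (subst powr_mult) (auto intro!: mult_left_mono)
  have "real (Suc n) powr p = real (Suc (n + k)) powr p * t powr (-p)"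
    unfolding eq using t by (subst powr_mult) (auto simp: powr_minus field_simps)
  also have "\<dots> \<le> real (Suc (n + k)) powr p * real (Suc k) powr \<bar>p\<bar>"
    using le[of "-p"] by (intro mult_left_mono) auto
  finally show "real (Suc n) powr p \<le> real (Suc (n + k)) powr p * real (Suc k) powr \<bar>p\<bar>" .
qed

lemma summable_Suc_powr: "p < -1 \<Longrightarrow> summable (\<lambda>n. real (Suc n) powr p)"
  using summable_real_powr_iff[of p] summable_Suc_iff[of "\<lambda>n. real n powr p"] by simp

lemma summable_powr_weight:
  fixes A :: "complex fps"
  assumes "fps_conv_radius A > 1"
  shows "summable (\<lambda>k. norm (fps_nth A k) * real (Suc k) powr p)"
proof -
  obtain r where r: "ereal 1 < ereal r" "ereal r < fps_conv_radius A"
    using ereal_dense2[OF assms[unfolded one_ereal_def]] by blast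
  have r1: "r > 1" using r by simp
  have sm: "summable (\<lambda>n. norm (fps_nth A n * of_real r ^ n))"
    by (rule abs_summable_in_conv_radius) (use r in \<open>auto simp: fps_conv_radius_def\<close>)
  have "c > 0 \<Longrightarrow> (\<lambda>k. real (Suc k) powr p * exp (- c * real k)) \<longlonglongrightarrow> 0" for c :: real
    by real_asymp
  from this[of "ln r"] have "(\<lambda>k. real (Suc k) powr p / r ^ k) \<longlonglongrightarrow> 0"
    using r1 by (simp add: exp_minus exp_of_nat2_mult divide_inverse)
  then obtain C where C: "\<And>k. norm (real (Suc k) powr p / r ^ k) \<le> C"
    using limit_imp_norm_bounded by blast
  show ?thesis
  proof (rule summable_comparison_test'[OF summable_mult[OF sm, of C]])
    fix k
    have "real (Suc k) powr p \<le> C * r ^ k"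
      using C[of k] r by (simp add: field_simps)
    from mult_left_mono[OF this, of "norm (fps_nth A k)"]
    show "norm (norm (fps_nth A k) * real (Suc k) powr p) \<le> C * norm (fps_nth A k * of_real r ^ k)"
      using r by (simp add: norm_mult norm_power mult_ac)
  qed
qed

text \<open>
  A factor with radius of convergence greater than 1 does not change the order of growth of the
  coefficients, nor does it destroy bounded partial sums (\<open>fps_mult_partial_sums_bounded\<close>). So the
  singularity of the generating functions at \<open>v = -1\<close> alone decides about convergence.
\<close>

lemma fps_mult_powr_bound:
  fixes A B :: "complex fps"
  assumes A: "fps_conv_radius A > 1"
    and B: "\<And>n. norm (fps_nth B n) \<le> C * real (Suc n) powr p"
  shows "\<exists>D. \<forall>n. norm (fps_nth (A * B) n) \<le> D * real (Suc n) powr p"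
proof (intro exI allI)
  fix n
  let ?w = "\<lambda>k. norm (fps_nth A k) * real (Suc k) powr \<bar>p\<bar>"
  have C0: "C \<ge> 0" using order.trans[OF norm_ge_zero B[of 0]] by simp
  have "norm (fps_nth (A * B) n) \<le> (\<Sum>k=0..n. norm (fps_nth A k) * norm (fps_nth B (n - k)))"
    unfolding fps_mult_nth by (rule order.trans[OF norm_sum]) (simp add: norm_mult)
  also have "\<dots> \<le> (\<Sum>k=0..n. ?w k * (C * real (Suc n) powr p))"
  proof (intro sum_mono)
    fix k assume k: "k \<in> {0..n}"
    have "norm (fps_nth B (n - k)) \<le> C * (real (Suc n) powr p * real (Suc k) powr \<bar>p\<bar>)"
      using B[of "n - k"] powr_shift_le(2)[of "n - k" p k] k C0
      by (auto intro: order.trans[OF _ mult_left_mono])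
    from mult_left_mono[OF this, of "norm (fps_nth A k)"]
    show "norm (fps_nth A k) * norm (fps_nth B (n - k)) \<le> ?w k * (C * real (Suc n) powr p)"
      by (simp add: mult_ac)
  qed
  also have "\<dots> = (\<Sum>k=0..n. ?w k) * (C * real (Suc n) powr p)"
    by (rule sum_distrib_right [symmetric])
  also have "\<dots> \<le> suminf ?w * (C * real (Suc n) powr p)"
    using C0 by (intro mult_right_mono sum_le_suminf summable_powr_weight A) auto
  finally show "norm (fps_nth (A * B) n) \<le> (suminf ?w * C) * real (Suc n) powr p"
    by (simp add: mult_ac)
qed

lemma sum_convolution_swap:
  fixes a h l :: "nat \<Rightarrow> complex"
  shows "(\<Sum>n<N. (\<Sum>k\<le>n. a k * h (n - k)) * l n) = (\<Sum>k<N. a k * (\<Sum>j<N-k. h j * l (j + k)))"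
proof -
  have "(\<Sum>n<N. (\<Sum>k\<le>n. a k * h (n - k)) * l n) = (\<Sum>n<N. \<Sum>k\<le>n. a k * (h (n - k) * l ((n - k) + k)))"
    by (intro sum.cong refl) (auto simp: sum_distrib_right mult.assoc)
  also have "\<dots> = (\<Sum>(k,j)\<in>{(i,j). i + j < N}. a k * (h j * l (j + k)))"
    by (subst sum.triangle_reindex) auto
  also have "{(i,j). i + j < N} = Sigma {..<N} (\<lambda>k. {..<N-k})"
    by auto
  also have "(\<Sum>(k,j)\<in>\<dots>. a k * (h j * l (j + k))) = (\<Sum>k<N. a k * (\<Sum>j<N-k. h j * l (j + k)))"
    by (subst sum.Sigma [symmetric]) (auto simp: sum_distrib_left)
  finally show ?thesis .
qed

lemma fps_mult_partial_sums_bounded: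
  fixes A B :: "complex fps"
  assumes A: "fps_conv_radius A > 1"
    and B: "\<And>N. norm (\<Sum>n<N. fps_nth B n) \<le> C"
  shows "\<exists>D. \<forall>N. norm (\<Sum>n<N. fps_nth (A * B) n) \<le> D"
proof (intro exI allI)
  fix N
  have sA: "summable (\<lambda>k. norm (fps_nth A k))"
    using summable_powr_weight[OF A, of 0] by simp
  have C0: "C \<ge> 0" using order.trans[OF norm_ge_zero B[of 0]] by simp
  have "(\<Sum>n<N. fps_nth (A * B) n) = (\<Sum>k<N. fps_nth A k * (\<Sum>j<N-k. fps_nth B j))"
    using sum_convolution_swap[of "fps_nth A" "fps_nth B" "\<lambda>_. 1" N]
    by (simp add: fps_mult_nth atLeast0AtMost)
  also have "norm \<dots> \<le> (\<Sum>k<N. norm (fps_nth A k) * C)"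
    by (intro order.trans[OF norm_sum] sum_mono) (auto simp: norm_mult intro!: mult_left_mono B)
  also have "\<dots> \<le> suminf (\<lambda>k. norm (fps_nth A k)) * C"
    unfolding sum_distrib_right[symmetric]
    using C0 sA by (intro mult_right_mono sum_le_suminf) auto
  finally show "norm (\<Sum>n<N. fps_nth (A * B) n) \<le> suminf (\<lambda>k. norm (fps_nth A k)) * C" .
qed

text \<open>
  Here \<open>l n\<close> stands for the \<open>n\<close>-th moment of a functional, and \<open>S k\<close> for its value at
  \<open>v^k\<close> times the series \<open>h\<close>. The functional may be applied to the product of the series \<open>a\<close> and \<open>h\<close>
  either coefficientwise or factor by factor. Absolute convergence in \<open>n\<close> would be too
  much to ask: for the inverse relation only the partial sums are under control, and Tannery's
  theorem in the variable \<open>k\<close> is enough.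
\<close>

lemma moment_rearrangement:
  fixes a h l S :: "nat \<Rightarrow> complex" and \<rho> :: "nat \<Rightarrow> real"
  assumes S: "\<And>k. (\<lambda>n. h n * l (n + k)) sums S k"
    and bd: "\<And>k N. norm (\<Sum>n<N. h n * l (n + k)) \<le> \<rho> k"
    and w: "summable (\<lambda>k. norm (a k) * \<rho> k)"
  shows "summable (\<lambda>k. a k * S k)"
    and "(\<lambda>n. (\<Sum>k\<le>n. a k * h (n - k)) * l n) sums (\<Sum>k. a k * S k)"
    and "(\<And>n. (\<lambda>k. a k * l (n + k)) sums t n) \<Longrightarrow> (\<lambda>n. h n * t n) sums (\<Sum>k. a k * S k)"
proof -
  let ?P = "\<lambda>k N. \<Sum>n<N. h n * l (n + k)"
  have P: "?P k \<longlonglongrightarrow> S k" for k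
    using S[of k] by (simp add: sums_def)
  have \<rho>0: "\<rho> k \<ge> 0" for k
    using bd[where k=k and N=0] by simp
  have dom: "\<forall>\<^sub>F N in sequentially. \<forall>k. norm (a k * ?P k N) \<le> norm (a k) * \<rho> k"
    by (auto simp: norm_mult intro!: always_eventually mult_left_mono bd)
  have lim: "(\<lambda>N. a k * ?P k N) \<longlonglongrightarrow> a k * S k" for k
    by (intro tendsto_intros P)
  have sm: "summable (\<lambda>k. a k * S k)"
    and T1: "(\<lambda>N. \<Sum>k. a k * ?P k N) \<longlonglongrightarrow> (\<Sum>k. a k * S k)"
    using tannery[OF dom w lim] by auto
  show "summable (\<lambda>k. a k * S k)" by fact
  \<comment> \<open>The \<open>N\<close>-th partial sum of the product series cuts the inner sums off at \<open>N - k\<close>.\<close>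
  have T2: "(\<lambda>N. \<Sum>k. a k * (if k < N then ?P k (N - k) else 0)) \<longlonglongrightarrow> (\<Sum>k. a k * S k)"
  proof (rule tannery[OF _ w])
    show "\<forall>\<^sub>F N in sequentially. \<forall>k. norm (a k * (if k < N then ?P k (N - k) else 0)) \<le> norm (a k) * \<rho> k"
      by (auto simp: norm_mult \<rho>0 intro!: always_eventually mult_left_mono bd)
    fix k
    have "(\<lambda>N. ?P k (N - k)) \<longlonglongrightarrow> S k"
      by (rule filterlim_compose[OF P]) (rule filterlim_minus_const_nat_at_top)
    hence "(\<lambda>N. if k < N then ?P k (N - k) else 0) \<longlonglongrightarrow> S k"
      by (rule Lim_transform_eventually) (use eventually_gt_at_top[of k] in \<open>auto elim: eventually_mono\<close>)
    thus "(\<lambda>N. a k * (if k < N then ?P k (N - k) else 0)) \<longlonglongrightarrow> a k * S k"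
      by (intro tendsto_intros)
  qed
  have "(\<Sum>k. a k * (if k < N then ?P k (N - k) else 0)) = (\<Sum>n<N. (\<Sum>k\<le>n. a k * h (n - k)) * l n)" for N
    unfolding sum_convolution_swap by (subst suminf_finite[of "{..<N}"]) auto
  with T2 show "(\<lambda>n. (\<Sum>k\<le>n. a k * h (n - k)) * l n) sums (\<Sum>k. a k * S k)"
    by (simp add: sums_def)
  assume t: "\<And>n. (\<lambda>k. a k * l (n + k)) sums t n"
  have "(\<Sum>k. a k * ?P k N) = (\<Sum>n<N. h n * t n)" for N
  proof -
    have "(\<lambda>k. \<Sum>n<N. h n * (a k * l (n + k))) sums (\<Sum>n<N. h n * t n)"
      by (intro sums_sum sums_mult t)
    thus ?thesis
      by (simp add: sums_iff sum_distrib_left mult_ac)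
  qed
  with T1 show "(\<lambda>n. h n * t n) sums (\<Sum>k. a k * S k)"
    by (simp add: sums_def)
qed

text \<open>
  Dirichlet's test, with a bound for the partial sums that is uniform in the shift \<open>k\<close>: summation by
  parts bounds them by the total variation and the supremum of \<open>l\<close>, which shifting can only decrease.
\<close>

lemma dirichlet_shifted:
  fixes h l :: "nat \<Rightarrow> complex"
  assumes H: "\<And>N. norm (\<Sum>n<N. h n) \<le> H"
    and V: "summable (\<lambda>n. norm (l n - l (Suc n)))" and l0: "l \<longlonglongrightarrow> 0"
  shows "summable (\<lambda>n. h n * l (n + k))"
    and "\<exists>R. \<forall>k N. norm (\<Sum>n<N. h n * l (n + k)) \<le> R"
proof -
  have H0: "H \<ge> 0" using H[of 0] by simp
  define P where "P = (\<lambda>N. \<Sum>n<N. h n)"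
  let ?d = "\<lambda>n. l n - l (Suc n)"
  \<comment> \<open>Summation by parts.\<close>
  have parts: "(\<Sum>n<N. h n * l (n + k)) = P N * l (N + k) + (\<Sum>n<N. P (Suc n) * ?d (n + k))" for N k
    by (induction N) (auto simp: P_def algebra_simps)
  obtain L where L: "\<And>n. norm (l n) \<le> L"
    using limit_imp_norm_bounded[OF l0] by blast
  have dk: "summable (\<lambda>n. norm (?d (n + k)))" for k
    using summable_ignore_initial_segment[OF V, of k] by simp
  have bdd: "(\<Sum>n<N. norm (?d (n + k))) \<le> suminf (\<lambda>n. norm (?d n))" for N k
  proof -
    have "(\<Sum>n<N. norm (?d (n + k))) = (\<Sum>n\<in>(\<lambda>n. n + k) ` {..<N}. norm (?d n))"
      by (subst sum.reindex) (auto simp: inj_on_def)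
    also have "\<dots> \<le> suminf (\<lambda>n. norm (?d n))"
      by (intro sum_le_suminf V) auto
    finally show ?thesis .
  qed
  have "norm (\<Sum>n<N. h n * l (n + k)) \<le> H * L + H * suminf (\<lambda>n. norm (?d n))" for N k
  proof -
    have "norm (\<Sum>n<N. h n * l (n + k)) \<le> norm (P N * l (N + k)) + (\<Sum>n<N. norm (P (Suc n) * ?d (n + k)))"
      unfolding parts by (intro norm_triangle_mono order.refl norm_sum)
    also have "\<dots> \<le> H * L + (\<Sum>n<N. H * norm (?d (n + k)))"
      unfolding norm_mult P_def
      by (intro add_mono sum_mono mult_mono H L H0) auto
    also have "\<dots> \<le> H * L + H * suminf (\<lambda>n. norm (?d n))"
      unfolding sum_distrib_left[symmetric] using bdd H0 by (intro add_mono mult_left_mono) auto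
    finally show ?thesis .
  qed
  thus "\<exists>R. \<forall>k N. norm (\<Sum>n<N. h n * l (n + k)) \<le> R" by blast
  have "summable (\<lambda>n. P (Suc n) * ?d (n + k))"
    by (rule summable_comparison_test'[OF summable_mult[OF dk, of H]])
       (auto simp: norm_mult P_def simp del: sum.lessThan_Suc intro!: mult_right_mono H)
  hence "(\<lambda>N. \<Sum>n<N. P (Suc n) * ?d (n + k)) \<longlonglongrightarrow> suminf (\<lambda>n. P (Suc n) * ?d (n + k))"
    by (rule summable_LIMSEQ)
  moreover have "(\<lambda>N. P N * l (N + k)) \<longlonglongrightarrow> 0"
  proof (rule Lim_null_comparison)
    show "\<forall>\<^sub>F N in sequentially. norm (P N * l (N + k)) \<le> H * norm (l (N + k))"
      unfolding norm_mult P_def by (intro always_eventually allI mult_right_mono H) auto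
    show "(\<lambda>N. H * norm (l (N + k))) \<longlonglongrightarrow> 0"
      using LIMSEQ_ignore_initial_segment[OF l0, of k] by (auto intro!: tendsto_eq_intros)
  qed
  ultimately have "(\<lambda>N. \<Sum>n<N. h n * l (n + k)) \<longlonglongrightarrow> 0 + suminf (\<lambda>n. P (Suc n) * ?d (n + k))"
    unfolding parts by (intro tendsto_add)
  thus "summable (\<lambda>n. h n * l (n + k))"
    by (auto simp: summable_def sums_def)
qed

section \<open>Asymptotics of Gamma quotients\<close>

text \<open>
  Away from the poles this is Gauss's product for \<open>\<Gamma>(c)\<close>. A pole is reached from \<open>c + m\<close>, with \<open>m\<close>
  large, by \<open>m\<close> applications of the functional equation.
\<close>

lemma rGamma_shift_asymp:
  fixes c :: complex
  shows "(\<lambda>n. rGamma (c + of_nat n) * fact n * of_nat n powr (c - 1)) \<longlonglongrightarrow> 1"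
proof -
  have regular: "(\<lambda>n. rGamma (c + of_nat n) * fact n * of_nat n powr (c - 1)) \<longlonglongrightarrow> 1"
    if c: "c \<notin> \<int>\<^sub>\<le>\<^sub>0" for c :: complex
  proof (rule Lim_transform_eventually)
    have "(\<lambda>n. rGamma c * Gamma_series' c n) \<longlonglongrightarrow> rGamma c * Gamma c"
      by (intro tendsto_intros Gamma_series'_LIMSEQ)
    thus "(\<lambda>n. rGamma c * Gamma_series' c n) \<longlonglongrightarrow> 1"
      using c by (simp add: rGamma_inverse_Gamma Gamma_eq_zero_iff)
    show "\<forall>\<^sub>F n in sequentially. rGamma c * Gamma_series' c n =
        rGamma (c + of_nat n) * fact n * of_nat n powr (c - 1)"
      using eventually_gt_at_top[of 0]
    proof eventually_elim
      case (elim n)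
      have "pochhammer c n \<noteq> 0"
        using c pochhammer_eq_0_imp_nonpos_Int by blast
      moreover have "rGamma c = pochhammer c n * rGamma (c + of_nat n)"
        by (rule pochhammer_rGamma)
      moreover have "(fact n :: complex) = of_nat n * fact (n - 1)"
        using elim by (simp add: fact_reduce)
      moreover have "of_nat n powr (c - 1) = exp (c * of_real (ln (real n))) / (of_nat n :: complex)"
        using elim by (simp add: powr_diff) (simp add: powr_def)
      ultimately show ?case
        using elim by (simp add: Gamma_series'_def field_simps)
    qed
  qed
  have shift: "(\<lambda>n. rGamma (c + of_nat n) * fact n * of_nat n powr (c - 1)) \<longlonglongrightarrow> 1"
    if "(\<lambda>n. rGamma (c + 1 + of_nat n) * fact n * of_nat n powr (c + 1 - 1)) \<longlonglongrightarrow> 1" for c :: complex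
  proof (rule Lim_transform_eventually)
    have "(\<lambda>n. (c * inverse (of_nat n) + 1) * (rGamma (c + 1 + of_nat n) * fact n * of_nat n powr (c + 1 - 1)))
            \<longlonglongrightarrow> (c * 0 + 1) * 1"
      by (intro tendsto_intros that lim_inverse_n)
    thus "(\<lambda>n. (c * inverse (of_nat n) + 1) * (rGamma (c + 1 + of_nat n) * fact n * of_nat n powr (c + 1 - 1))) \<longlonglongrightarrow> 1"
      by simp
    show "\<forall>\<^sub>F n in sequentially. (c * inverse (of_nat n) + 1) * (rGamma (c + 1 + of_nat n) * fact n * of_nat n powr (c + 1 - 1)) =
        rGamma (c + of_nat n) * fact n * of_nat n powr (c - 1)"
      using eventually_gt_at_top[of 0]
    proof eventually_elim
      case (elim n)
      have e1: "rGamma (c + of_nat n) = (c + of_nat n) * rGamma (c + 1 + of_nat n)"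
        using rGamma_plus1[of "c + of_nat n"] by (simp add: add_ac)
      have e2: "of_nat n powr (c + 1 - 1) = of_nat n * (of_nat n powr (c - 1) :: complex)"
        using elim by (simp add: powr_diff)
      have e3: "(c * inverse (of_nat n) + 1) * of_nat n = c + of_nat n"
        using elim by (simp add: field_simps)
      have "(c * inverse (of_nat n) + 1) * (rGamma (c + 1 + of_nat n) * fact n * of_nat n powr (c + 1 - 1)) =
          ((c * inverse (of_nat n) + 1) * of_nat n) * rGamma (c + 1 + of_nat n) * fact n * of_nat n powr (c - 1)"
        unfolding e2 by (simp only: mult_ac)
      thus ?case
        unfolding e1 e3 .
    qed
  qed
  \<comment> \<open>Every \<open>c\<close> is \<open>m\<close> steps to the left of a point that is not a pole.\<close>
  obtain m :: nat where m: "- Re c < real m"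
    using reals_Archimedean2 by blast
  have "(\<lambda>n. rGamma (c + of_nat m + of_nat n) * fact n * of_nat n powr (c + of_nat m - 1)) \<longlonglongrightarrow> 1"
  proof (rule regular, rule notI)
    assume "c + of_nat m \<in> \<int>\<^sub>\<le>\<^sub>0"
    then obtain n where "c + of_nat m = - of_nat n"
      by (elim nonpos_Ints_cases')
    hence "Re (c + of_nat m) = Re (- of_nat n)"
      by simp
    thus False using m by simp
  qed
  thus ?thesis
  proof (induction m)
    case (Suc m)
    have eq: "c + of_nat (Suc m) = c + of_nat m + 1"
      by simp
    show ?case
      by (rule Suc.IH, rule shift) (use Suc.prems in \<open>simp only: eq\<close>)
  qed simp
qed

lemma pochhammer_asymp:
  fixes s :: complex
  shows "(\<lambda>n. pochhammer s n / fact n * of_nat n powr (1 - s)) \<longlonglongrightarrow> rGamma s"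
proof (rule Lim_transform_eventually)
  show "(\<lambda>n. (- s gchoose n) / ((-1)^n / exp ((- s + 1) * of_real (ln (real n))))) \<longlonglongrightarrow> rGamma s"
    using gbinomial_asymptotic[of "- s"] by (simp add: rGamma_inverse_Gamma)
  show "\<forall>\<^sub>F n in sequentially. (- s gchoose n) / ((-1)^n / exp ((- s + 1) * of_real (ln (real n)))) =
      pochhammer s n / fact n * of_nat n powr (1 - s)"
    using eventually_gt_at_top[of 0]
  proof eventually_elim
    case (elim n)
    have "of_nat n powr (1 - s) = exp ((- s + 1) * of_real (ln (real n)))"
      using elim by (simp add: powr_def)
    thus ?case
      by (simp add: gbinomial_pochhammer flip: power_mult_distrib)
  qed
qed

text \<open>
  The weight is \<open>n + 1\<close> rather than \<open>n\<close>, so that the estimate covers \<open>n = 0\<close>.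
\<close>

lemma asymp_imp_powr_bound:
  fixes f :: "nat \<Rightarrow> complex"
  assumes "(\<lambda>n. f n * of_nat n powr c) \<longlonglongrightarrow> L"
  shows "\<exists>C. \<forall>n. norm (f n) \<le> C * real (Suc n) powr (- Re c)"
proof -
  obtain C where C: "\<And>n. norm (f n * of_nat n powr c) \<le> C"
    using limit_imp_norm_bounded[OF assms] by blast
  let ?D = "max (norm (f 0)) (C * 2 powr \<bar>Re c\<bar>)"
  have C0: "C \<ge> 0" using order.trans[OF norm_ge_zero C] .
  have "norm (f n) \<le> ?D * real (Suc n) powr (- Re c)" for n
  proof (cases n)
    case (Suc m)
    have "norm (f n) * real n powr Re c \<le> C"
      using C[of n] Suc norm_powr_real_powr[of "of_nat n" c] by (simp add: norm_mult)
    hence "norm (f n) \<le> C * real n powr (- Re c)"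
      using Suc by (simp add: powr_minus field_simps)
    also have "\<dots> \<le> C * (real (Suc n) powr (- Re c) * 2 powr \<bar>Re c\<bar>)"
      using powr_shift_le(2)[of m "- Re c" 1] C0 Suc by (intro mult_left_mono) (auto simp: numeral_2_eq_2)
    also have "\<dots> \<le> ?D * real (Suc n) powr (- Re c)"
      using mult_right_mono[of "C * 2 powr \<bar>Re c\<bar>" ?D "real (Suc n) powr (- Re c)"]
      by (simp add: mult_ac)
    finally show ?thesis .
  qed auto
  thus ?thesis by blast
qed

lemma gbinomial_powr_bound:
  fixes a :: complex
  shows "\<exists>C. \<forall>n. norm (a gchoose n) \<le> C * real (Suc n) powr (- Re a - 1)"
proof -
  have "\<exists>C. \<forall>n. norm (pochhammer (-a) n / fact n) \<le> C * real (Suc n) powr (- Re (1 - - a))"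
    by (rule asymp_imp_powr_bound[OF pochhammer_asymp])
  moreover have "- Re (1 - - a) = - Re a - 1"
    by simp
  ultimately show ?thesis
    by (simp only: gbinomial_pochhammer norm_mult norm_divide norm_power) simp
qed

lemma limseq_even_odd:
  fixes f :: "nat \<Rightarrow> 'a :: topological_space"
  assumes "(\<lambda>n. f (2 * n)) \<longlonglongrightarrow> L" "(\<lambda>n. f (2 * n + 1)) \<longlonglongrightarrow> L"
  shows "f \<longlonglongrightarrow> L"
proof (rule topological_tendstoI)
  fix S assume S: "open S" "L \<in> S"
  obtain N1 N2 where "\<And>n. n \<ge> N1 \<Longrightarrow> f (2 * n) \<in> S" "\<And>n. n \<ge> N2 \<Longrightarrow> f (2 * n + 1) \<in> S"
    using topological_tendstoD[OF assms(1) S] topological_tendstoD[OF assms(2) S]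
    by (auto simp: eventually_sequentially)
  hence "f n \<in> S" if "n \<ge> 2 * (N1 + N2) + 1" for n
    using that by (cases "even n") (auto elim!: evenE oddE)
  thus "\<forall>\<^sub>F n in sequentially. f n \<in> S"
    by (auto simp: eventually_sequentially)
qed

section \<open>Moments of the two weights\<close>

text \<open>
  For \<open>Re s > 0\<close> and \<open>Re \<nu> > -1\<close> this is
  \<open>1 / (\<Gamma>(s) \<Gamma>(\<nu>+1)) \<integral>\<^sub>0\<^sup>1 v^(s+n-1) (1 - v)^\<nu> dv\<close>. With this normalisation the moments are entire
  in \<open>s\<close> and \<open>\<nu>\<close>.
\<close>

definition beta_moment :: "complex \<Rightarrow> complex \<Rightarrow> nat \<Rightarrow> complex" where
  "beta_moment \<nu> s n = pochhammer s n * rGamma (s + \<nu> + 1 + of_nat n)"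

text \<open>
  The function \<open>\<Gamma>(s/2) / (2 \<Gamma>(s))\<close>, written by means of the duplication formula so as to be entire.
\<close>

definition half_Gamma_quot :: "complex \<Rightarrow> complex" where
  "half_Gamma_quot s = of_real (sqrt pi) * 2 powr (- s) * rGamma ((s + 1) / 2)"

text \<open>
  For \<open>Re s > 0\<close> and \<open>Re \<nu> > -1\<close> this is
  \<open>1 / (\<Gamma>(s) \<Gamma>(\<nu>+1)) \<integral>\<^sub>0\<^sup>1 v^(s+n-1) (1 - v\<^sup>2)^\<nu> dv\<close>.
\<close>

definition sq_moment :: "complex \<Rightarrow> complex \<Rightarrow> nat \<Rightarrow> complex" where
  "sq_moment \<nu> s n = pochhammer s n * half_Gamma_quot (s + of_nat n) *
     rGamma ((s + of_nat n) / 2 + \<nu> + 1)"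

lemma rGamma_step: "z + 1 = w \<Longrightarrow> rGamma z = z * rGamma w"
  for z :: complex
  using rGamma_plus1[of z] by simp

lemma half_Gamma_quot_shift: "half_Gamma_quot s = 2 * (s + 1) * half_Gamma_quot (s + 2)"
proof -
  have "rGamma ((s + 1) / 2) = (s + 1) / 2 * rGamma ((s + 2 + 1) / 2)"
    by (rule rGamma_step) (simp add: field_simps)
  moreover have "(2::complex) powr (- (s + 2)) = 2 powr (- s) / 4"
    by (simp add: powr_diff)
  ultimately show ?thesis
    unfolding half_Gamma_quot_def by (simp only:) simp
qed

lemma half_Gamma_quot_pochhammer:
  "pochhammer s (2 * m) * half_Gamma_quot (s + of_nat (2 * m)) = half_Gamma_quot s * pochhammer (s / 2) m"
proof (induction m)
  case (Suc m)
  define t where "t = s + of_nat (2 * m)"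
  have "pochhammer s (2 * Suc m) = pochhammer s (2 * m) * t * (t + 1)"
    by (simp add: pochhammer_Suc t_def add_ac)
  moreover have "t + 2 = s + of_nat (2 * Suc m)"
    by (simp add: t_def)
  ultimately have "pochhammer s (2 * Suc m) * half_Gamma_quot (s + of_nat (2 * Suc m)) =
      pochhammer s (2 * m) * t * ((t + 1) * half_Gamma_quot (t + 2))"
    by (simp only: mult.assoc)
  also have "(t + 1) * half_Gamma_quot (t + 2) = half_Gamma_quot t / 2"
    unfolding half_Gamma_quot_shift[of t] by simp
  also have "pochhammer s (2 * m) * t * (half_Gamma_quot t / 2) =
      pochhammer s (2 * m) * half_Gamma_quot t * (t / 2)"
    by simp
  also have "t / 2 = s / 2 + of_nat m"
    by (simp add: t_def add_divide_distrib)
  also have "pochhammer s (2 * m) * half_Gamma_quot t = half_Gamma_quot s * pochhammer (s / 2) m"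
    unfolding t_def by (rule Suc.IH)
  finally show ?case
    by (simp only: pochhammer_Suc mult.assoc)
qed simp

lemma beta_moment_add: "beta_moment \<nu> s (n + k) = pochhammer s n * beta_moment \<nu> (s + of_nat n) k"
  unfolding beta_moment_def pochhammer_product' by (simp add: add_ac)

lemma sq_moment_add: "sq_moment \<nu> s (n + k) = pochhammer s n * sq_moment \<nu> (s + of_nat n) k"
  unfolding sq_moment_def pochhammer_product' by (simp add: add_ac)

text \<open>
  On even powers of \<open>v\<close>, substituting \<open>v\<^sup>2\<close> for \<open>v\<close> reduces the weight \<open>(1 - v\<^sup>2)^\<nu>\<close> to \<open>(1 - v)^\<nu>\<close>.
\<close>

lemma sq_moment_even: "sq_moment \<nu> s (2 * m) = half_Gamma_quot s * beta_moment \<nu> (s / 2) m"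
proof -
  have "(s + of_nat (2 * m)) / 2 + \<nu> + 1 = s / 2 + \<nu> + 1 + of_nat m"
    by (simp add: add_divide_distrib)
  thus ?thesis
    unfolding sq_moment_def beta_moment_def half_Gamma_quot_pochhammer by (simp only: mult.assoc)
qed

lemma beta_moment_asymp:
  "(\<lambda>n. beta_moment \<nu> s n * of_nat n powr (\<nu> + 1)) \<longlonglongrightarrow> rGamma s"
proof (rule Lim_transform_eventually)
  show "(\<lambda>n. (pochhammer s n / fact n * of_nat n powr (1 - s)) *
          (rGamma (s + \<nu> + 1 + of_nat n) * fact n * of_nat n powr (s + \<nu> + 1 - 1))) \<longlonglongrightarrow> rGamma s"
    using tendsto_mult[OF pochhammer_asymp[of s] rGamma_shift_asymp[of "s + \<nu> + 1"]] by simp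
  show "\<forall>\<^sub>F n in sequentially. (pochhammer s n / fact n * of_nat n powr (1 - s)) *
          (rGamma (s + \<nu> + 1 + of_nat n) * fact n * of_nat n powr (s + \<nu> + 1 - 1)) =
        beta_moment \<nu> s n * of_nat n powr (\<nu> + 1)"
    using eventually_gt_at_top[of 0]
  proof eventually_elim
    case (elim n)
    have "(of_nat n :: complex) powr (\<nu> + 1) = of_nat n powr (1 - s) * of_nat n powr (s + \<nu> + 1 - 1)"
      by (simp only: powr_add[symmetric]) (simp add: add.commute)
    thus ?case
      by (simp add: beta_moment_def)
  qed
qed

lemma beta_moment_powr_bound:
  "\<exists>C. \<forall>n. norm (beta_moment \<nu> s n) \<le> C * real (Suc n) powr (- Re \<nu> - 1)"
  using asymp_imp_powr_bound[OF beta_moment_asymp[of \<nu> s]] by simp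

text \<open>
  Legendre's duplication formula, extended to the poles, where both sides vanish.
\<close>

lemma half_Gamma_quot_rGamma: "half_Gamma_quot s * rGamma (s / 2) * 2 = rGamma s"
proof (cases "s / 2 \<in> \<int>\<^sub>\<le>\<^sub>0 \<or> s / 2 + 1 / 2 \<in> \<int>\<^sub>\<le>\<^sub>0")
  case True
  have "\<exists>n. s = - of_nat n"
    using True
  proof
    assume "s / 2 \<in> \<int>\<^sub>\<le>\<^sub>0"
    then obtain n where n: "s / 2 = - of_nat n" by (elim nonpos_Ints_cases')
    have "s = 2 * (s / 2)" by simp
    also have "\<dots> = - of_nat (2 * n)" unfolding n by simp
    finally show ?thesis by blast
  next
    assume "s / 2 + 1 / 2 \<in> \<int>\<^sub>\<le>\<^sub>0"
    then obtain n where n: "s / 2 + 1 / 2 = - of_nat n" by (elim nonpos_Ints_cases')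
    have "s = 2 * (s / 2 + 1 / 2) - 1" by simp
    also have "\<dots> = - of_nat (2 * n + 1)" unfolding n by simp
    finally show ?thesis by blast
  qed
  hence "rGamma s = 0" by auto
  moreover have "rGamma (s / 2) = 0 \<or> rGamma ((s + 1) / 2) = 0"
    using True by (simp add: rGamma_eq_zero_iff add_divide_distrib)
  ultimately show ?thesis by (auto simp: half_Gamma_quot_def)
next
  case False
  have "exp ((1 - 2 * (s / 2)) * of_real (ln 2)) = (2::complex) powr (1 - s)"
    using Ln_of_real[of 2] by (simp add: powr_def)
  also have "\<dots> = 2 * 2 powr (- s)"
    by (simp add: powr_diff powr_minus divide_inverse)
  finally have dup: "Gamma (s / 2) * Gamma (s / 2 + 1 / 2) = 2 * 2 powr (- s) * of_real (sqrt pi) * Gamma s"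
    using Gamma_legendre_duplication[of "s / 2"] False by simp
  have "half_Gamma_quot s * rGamma (s / 2) * 2 =
      2 * 2 powr (- s) * of_real (sqrt pi) / (Gamma (s / 2) * Gamma (s / 2 + 1 / 2))"
    unfolding half_Gamma_quot_def rGamma_inverse_Gamma add_divide_distrib
    by (simp only: divide_inverse inverse_mult_distrib mult_ac)
  also have "\<dots> = inverse (Gamma s)"
    unfolding dup by (simp add: field_simps)
  finally show ?thesis
    by (simp only: rGamma_inverse_Gamma)
qed

text \<open>
  Even and odd moments are multiples of moments of the first kind at \<open>s/2\<close> and \<open>(s + 1)/2\<close>. That the two
  subsequences have the same limit is what later makes consecutive moments equal to leading order
  (\<open>inverse_kummer\<close>).
\<close>

lemma sq_moment_asymp:
  "(\<lambda>n. sq_moment \<nu> s n * of_nat n powr (\<nu> + 1)) \<longlonglongrightarrow> 2 powr \<nu> * rGamma s"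
proof -
  note q = half_Gamma_quot_rGamma
  have two: "(2::complex) powr (\<nu> + 1) = 2 * 2 powr \<nu>"
    by (simp add: powr_add)
  have pw: "(of_nat (2 * n) :: complex) powr c = 2 powr c * of_nat n powr c" for n c
    by (simp add: powr_times_real)
  have even: "(\<lambda>n. sq_moment \<nu> s (2 * n) * of_nat (2 * n) powr (\<nu> + 1)) \<longlonglongrightarrow> 2 powr \<nu> * rGamma s" for s
  proof -
    have "(\<lambda>n. half_Gamma_quot s * 2 powr (\<nu> + 1) * (beta_moment \<nu> (s / 2) n * of_nat n powr (\<nu> + 1)))
           \<longlonglongrightarrow> half_Gamma_quot s * 2 powr (\<nu> + 1) * rGamma (s / 2)"
      by (intro tendsto_intros beta_moment_asymp)
    also have "half_Gamma_quot s * 2 powr (\<nu> + 1) * rGamma (s / 2) = 2 powr \<nu> * rGamma s"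
      unfolding two q[of s, symmetric] by simp
    also have "(\<lambda>n. half_Gamma_quot s * 2 powr (\<nu> + 1) * (beta_moment \<nu> (s / 2) n * of_nat n powr (\<nu> + 1))) =
          (\<lambda>n. sq_moment \<nu> s (2 * n) * of_nat (2 * n) powr (\<nu> + 1))"
      unfolding sq_moment_even pw by (simp only: mult_ac)
    finally show ?thesis .
  qed
  show ?thesis
  proof (rule limseq_even_odd)
    show "(\<lambda>n. sq_moment \<nu> s (2 * n) * of_nat (2 * n) powr (\<nu> + 1)) \<longlonglongrightarrow> 2 powr \<nu> * rGamma s"
      by (rule even)
    have ratio: "(\<lambda>n. (of_nat (2 * n + 1) / of_nat (2 * n)) powr (\<nu> + 1) :: complex) \<longlonglongrightarrow> 1 powr (\<nu> + 1)"
    proof (rule tendsto_powr_complex [OF _ _ tendsto_const])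
      have "(\<lambda>n. of_real ((2 * real n + 1) / (2 * real n)) :: complex) \<longlonglongrightarrow> of_real 1"
        by (intro tendsto_of_real) real_asymp
      thus "(\<lambda>n. of_nat (2 * n + 1) / of_nat (2 * n) :: complex) \<longlonglongrightarrow> 1" by (simp add: add.commute)
    qed auto
    show "(\<lambda>n. sq_moment \<nu> s (2 * n + 1) * of_nat (2 * n + 1) powr (\<nu> + 1)) \<longlonglongrightarrow> 2 powr \<nu> * rGamma s"
    proof (rule Lim_transform_eventually)
      have "(\<lambda>n. s * (sq_moment \<nu> (s + 1) (2 * n) * of_nat (2 * n) powr (\<nu> + 1)) *
              (of_nat (2 * n + 1) / of_nat (2 * n)) powr (\<nu> + 1)) \<longlonglongrightarrow>
            s * (2 powr \<nu> * rGamma (s + 1)) * 1 powr (\<nu> + 1)"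
        by (intro tendsto_intros even ratio)
      also have "s * (2 powr \<nu> * rGamma (s + 1)) * 1 powr (\<nu> + 1) = 2 powr \<nu> * rGamma s"
        using rGamma_plus1[of s] by (simp add: mult_ac)
      finally show "(\<lambda>n. s * (sq_moment \<nu> (s + 1) (2 * n) * of_nat (2 * n) powr (\<nu> + 1)) *
              (of_nat (2 * n + 1) / of_nat (2 * n)) powr (\<nu> + 1)) \<longlonglongrightarrow> 2 powr \<nu> * rGamma s" .
      show "\<forall>\<^sub>F n in sequentially. s * (sq_moment \<nu> (s + 1) (2 * n) * of_nat (2 * n) powr (\<nu> + 1)) *
              (of_nat (2 * n + 1) / of_nat (2 * n)) powr (\<nu> + 1) =
            sq_moment \<nu> s (2 * n + 1) * of_nat (2 * n + 1) powr (\<nu> + 1)"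
        using eventually_gt_at_top[of 0]
      proof eventually_elim
        case (elim n)
        have "(of_nat (2 * n + 1) :: complex) = of_real (real (2 * n)) * of_real (real (2 * n + 1) / real (2 * n))"
          unfolding of_real_mult [symmetric] using elim by simp
        hence "(of_nat (2 * n + 1) :: complex) powr (\<nu> + 1) =
            of_real (real (2 * n)) powr (\<nu> + 1) * of_real (real (2 * n + 1) / real (2 * n)) powr (\<nu> + 1)"
          by (simp only:) (rule powr_times_real; simp)
        also have "complex_of_real (real (2 * n)) = of_nat (2 * n)"
          by (rule of_real_of_nat_eq)
        also have "complex_of_real (real (2 * n + 1) / real (2 * n)) = of_nat (2 * n + 1) / of_nat (2 * n)"
          by (simp only: of_real_divide of_real_of_nat_eq)
        finally have "(of_nat (2 * n + 1) :: complex) powr (\<nu> + 1) =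
            of_nat (2 * n) powr (\<nu> + 1) * (of_nat (2 * n + 1) / of_nat (2 * n)) powr (\<nu> + 1)" .
        moreover have "sq_moment \<nu> s (2 * n + 1) = s * sq_moment \<nu> (s + 1) (2 * n)"
          using sq_moment_add[of \<nu> s 1 "2 * n"] by simp
        ultimately show ?case by (simp only: mult.assoc)
      qed
    qed
  qed
qed

lemma sq_moment_powr_bound:
  "\<exists>C. \<forall>n. norm (sq_moment \<nu> s n) \<le> C * real (Suc n) powr (- Re \<nu> - 1)"
  using asymp_imp_powr_bound[OF sq_moment_asymp[of \<nu> s]] by simp

section \<open>Kummer's theorem\<close>

lemma beta_moment_Suc: "beta_moment \<nu> s (Suc k) = s * beta_moment \<nu> (s + 1) k"
  using beta_moment_add[of \<nu> s 1 k] by simp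

lemma beta_moment_diff:
  "beta_moment \<nu> s k - beta_moment \<nu> s (Suc k) = (\<nu> + 1) * beta_moment (\<nu> + 1) s k"
proof -
  have "rGamma (s + \<nu> + 1 + of_nat k) = (s + \<nu> + 1 + of_nat k) * rGamma (s + (\<nu> + 1) + 1 + of_nat k)"
    by (rule rGamma_step) simp
  moreover have "s + \<nu> + 1 + of_nat (Suc k) = s + (\<nu> + 1) + 1 + of_nat k"
    by simp
  ultimately show ?thesis
    unfolding beta_moment_def pochhammer_Suc by (simp only:) (simp only: ring_distribs mult_ac; simp)
qed

lemma beta_moment_raise:
  "(s + of_nat k) * beta_moment (\<nu> + 1) s k = beta_moment \<nu> s (Suc k)"
proof -
  have "s + \<nu> + 1 + of_nat (Suc k) = s + (\<nu> + 1) + 1 + of_nat k"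
    by simp
  thus ?thesis
    unfolding beta_moment_def pochhammer_Suc by (simp only: mult_ac)
qed

lemma gbinomial_Suc_times: "of_nat (Suc k) * (a gchoose Suc k) = (a - of_nat k) * (a gchoose k)"
  for a :: complex
  using gbinomial_mult_1[of a k] by (simp add: algebra_simps)

text \<open>
  The relation between the exponents \<open>\<nu> + 1\<close> and \<open>\<nu>\<close> of the weight that is obtained from
  \<open>0 = \<integral> d(v^s (1 - v\<^sup>2)^(\<nu>+1))\<close> when \<open>(1 - v\<^sup>2)^(\<nu>+1)\<close> is written as \<open>(1 - v)^(\<nu>+1) (1 + v)^(\<nu>+1)\<close>
  and the second factor is expanded. The remainder is a single term, so the formula passes
  convergence from \<open>\<nu> + 1\<close> down to \<open>\<nu>\<close>.
\<close>

lemma kummer_telescope_exponent: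
  fixes \<nu> s :: complex
  shows "(\<nu> + 1 + s / 2) * (\<Sum>k\<le>N. ((\<nu> + 1) gchoose k) * beta_moment (\<nu> + 1) s k) =
     (\<Sum>k\<le>N. (\<nu> gchoose k) * beta_moment \<nu> s k) - (\<nu> gchoose N) * beta_moment \<nu> s (Suc N) / 2"
proof (induction N)
  case 0
  show ?case
    using beta_moment_diff[of \<nu> s 0] beta_moment_raise[of s 0 \<nu>] by (simp add: algebra_simps)
next
  case (Suc k)
  let ?b0 = "\<nu> gchoose k" and ?b1 = "\<nu> gchoose Suc k" and ?B = "(\<nu> + 1) gchoose Suc k"
  let ?l1 = "beta_moment \<nu> s (Suc k)" and ?l2 = "beta_moment \<nu> s (Suc (Suc k))"
  let ?L = "beta_moment (\<nu> + 1) s (Suc k)"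
  have B: "?B = ?b0 + ?b1"
    by (rule gbinomial_Suc_Suc)
  have kB: "of_nat (Suc k) * ?B = (\<nu> + 1) * ?b0"
    by (simp only: gbinomial_factors) (simp del: of_nat_Suc)
  have d: "?l1 - ?l2 = (\<nu> + 1) * ?L"
    by (rule beta_moment_diff)
  have r: "(s + of_nat (Suc k)) * ?L = ?l2"
    by (rule beta_moment_raise)
  have "s * ?B * ?L = ?B * ?l2 - (of_nat (Suc k) * ?B) * ?L"
    unfolding r [symmetric] by (simp only: ring_distribs mult_ac) simp
  also have "\<dots> = ?B * ?l2 - ?b0 * (?l1 - ?l2)"
    unfolding kB d by (simp only: mult_ac)
  finally have sBL: "s * ?B * ?L = ?B * ?l2 - ?b0 * (?l1 - ?l2)" .
  \<comment> \<open>The factor \<open>\<nu> + 1\<close> lowers the exponent, the factor \<open>s/2\<close> has been treated above.\<close>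
  have "(\<nu> + 1 + s / 2) * (?B * ?L) = ?B * ((\<nu> + 1) * ?L) + (s * ?B * ?L) / 2"
    by (simp add: field_simps)
  also have "\<dots> = ?B * (?l1 - ?l2) + (?B * ?l2 - ?b0 * (?l1 - ?l2)) / 2"
    unfolding sBL d ..
  also have "\<dots> = ?b1 * ?l1 - ?b1 * ?l2 / 2 + ?b0 * ?l1 / 2"
    unfolding B by (simp add: field_simps)
  finally have "(\<nu> + 1 + s / 2) * (?B * ?L) = ?b1 * ?l1 - ?b1 * ?l2 / 2 + ?b0 * ?l1 / 2" .
  with Suc.IH show ?case
    by (simp only: sum.atMost_Suc ring_distribs) (simp only: algebra_simps)
qed

text \<open>
  The companion relation, between the parameters \<open>s\<close> and \<open>s + 2\<close>. In the induction step all terms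
  are polynomial multiples of one quantity \<open>Z\<close>, so that it reduces to a polynomial identity.
\<close>

lemma kummer_telescope_parameter:
  fixes \<nu> s :: complex
  shows "(\<Sum>k\<le>N. ((\<nu> + 1) gchoose k) * beta_moment (\<nu> + 1) s k) =
     2 * (s + 1) * (\<Sum>k<N. (\<nu> gchoose k) * beta_moment \<nu> (s + 2) k) +
     (\<nu> gchoose N) * beta_moment \<nu> (s + 1) N"
proof (induction N)
  case 0
  show ?case
    by (simp add: beta_moment_def add_ac)
next
  case (Suc k)
  let ?b0 = "\<nu> gchoose k" and ?b1 = "\<nu> gchoose Suc k"
  define Z where "Z = pochhammer (s + 1) k * rGamma (s + \<nu> + 3 + of_nat k)"
  have e1: "beta_moment (\<nu> + 1) s (Suc k) = s * Z"
    unfolding beta_moment_def Z_def pochhammer_rec by (simp add: add_ac)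
  have e2: "(s + 1) * beta_moment \<nu> (s + 2) k = (s + 1 + of_nat k) * Z"
  proof -
    have "(s + 1) * pochhammer (s + 2) k = pochhammer (s + 1) k * (s + 1 + of_nat k)"
      using pochhammer_rec[of "s + 1" k] pochhammer_Suc[of "s + 1" k] by (simp add: add_ac)
    moreover have "s + 2 + \<nu> + 1 + of_nat k = s + \<nu> + 3 + of_nat k"
      by simp
    ultimately show ?thesis
      unfolding beta_moment_def Z_def by (metis mult.assoc mult.commute)
  qed
  have e3: "beta_moment \<nu> (s + 1) (Suc k) = (s + 1 + of_nat k) * Z"
    unfolding beta_moment_def Z_def pochhammer_Suc by (simp add: add_ac)
  have e4: "beta_moment \<nu> (s + 1) k = (s + \<nu> + 2 + of_nat k) * Z"
  proof -
    have "rGamma (s + 1 + \<nu> + 1 + of_nat k) = (s + 1 + \<nu> + 1 + of_nat k) * rGamma (s + \<nu> + 3 + of_nat k)"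
      by (rule rGamma_step) simp
    thus ?thesis
      unfolding beta_moment_def Z_def by (simp add: add_ac)
  qed
  have B: "(\<nu> + 1) gchoose Suc k = ?b0 + ?b1"
    by (rule gbinomial_Suc_Suc)
  have "of_nat (Suc k) * ?b1 = (\<nu> - of_nat k) * ?b0"
    by (rule gbinomial_Suc_times)
  hence "s * (?b0 + ?b1) = 2 * ?b0 * (s + 1 + of_nat k) + ?b1 * (s + 1 + of_nat k) - ?b0 * (s + \<nu> + 2 + of_nat k)"
    by (simp add: algebra_simps)
  hence "(?b0 + ?b1) * (s * Z) = 2 * ?b0 * ((s + 1 + of_nat k) * Z) + ?b1 * ((s + 1 + of_nat k) * Z)
      - ?b0 * ((s + \<nu> + 2 + of_nat k) * Z)"
    by algebra
  hence "((\<nu> + 1) gchoose Suc k) * beta_moment (\<nu> + 1) s (Suc k) =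
      2 * (s + 1) * (?b0 * beta_moment \<nu> (s + 2) k) +
      ?b1 * beta_moment \<nu> (s + 1) (Suc k) - ?b0 * beta_moment \<nu> (s + 1) k"
    unfolding B e1 e3 e4 e2 [symmetric] by (simp only: mult_ac)
  with Suc.IH show ?case
    by (simp only: sum.atMost_Suc sum.lessThan_Suc ring_distribs) (simp add: algebra_simps)
qed

text \<open>
  For \<open>Re \<nu> > 0\<close> the binomial series converges absolutely at 1, and its value there is the limit of
  its values at points of the open interval.
\<close>

lemma binomial_sum_at_1:
  fixes \<nu> :: complex
  assumes "Re \<nu> > 0"
  shows "(\<Sum>k. \<nu> gchoose k) = 2 powr \<nu>" and "summable (\<lambda>k. norm (\<nu> gchoose k))"
proof -
  obtain C where C: "\<And>n. norm (\<nu> gchoose n) \<le> C * real (Suc n) powr (- Re \<nu> - 1)"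
    using gbinomial_powr_bound by blast
  show sm: "summable (\<lambda>k. norm (\<nu> gchoose k))"
    by (rule summable_comparison_test'[OF summable_mult[OF summable_Suc_powr]])
       (use C assms in auto)
  \<comment> \<open>Any sequence in \<open>[0, 1)\<close> with limit 1 would do.\<close>
  define x where "x = (\<lambda>N. 1 - 1 / real (Suc N))"
  have x: "0 \<le> x N" "x N < 1" for N
    by (auto simp: x_def)
  have x1: "x \<longlonglongrightarrow> 1"
    unfolding x_def by real_asymp
  have "(\<lambda>N. \<Sum>k. (\<nu> gchoose k) * of_real (x N) ^ k) \<longlonglongrightarrow> (\<Sum>k. \<nu> gchoose k)"
  proof (rule tannery(2)[OF _ sm])
    show "\<forall>\<^sub>F N in sequentially. \<forall>k. norm ((\<nu> gchoose k) * of_real (x N) ^ k) \<le> norm (\<nu> gchoose k)"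
      using x by (auto simp: norm_mult norm_power power_le_one less_imp_le intro!: always_eventually mult_left_le)
    have "(\<lambda>N. (\<nu> gchoose k) * of_real (x N) ^ k) \<longlonglongrightarrow> (\<nu> gchoose k) * of_real 1 ^ k" for k
      by (intro tendsto_intros x1)
    thus "(\<lambda>N. (\<nu> gchoose k) * of_real (x N) ^ k) \<longlonglongrightarrow> (\<nu> gchoose k)" for k
      by simp
  qed
  moreover have "(\<Sum>k. (\<nu> gchoose k) * of_real (x N) ^ k) = (1 + of_real (x N)) powr \<nu>" for N
    using gen_binomial_complex[of "of_real (x N)" \<nu>] x[of N] by (simp add: sums_iff)
  moreover have "(\<lambda>N. (1 + of_real (x N)) powr \<nu>) \<longlonglongrightarrow> (1 + of_real 1) powr \<nu>"
    by (intro tendsto_powr_complex tendsto_intros x1) (auto simp: complex_nonpos_Reals_iff)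
  ultimately show "(\<Sum>k. \<nu> gchoose k) = 2 powr \<nu>"
    using LIMSEQ_unique by fastforce
qed

text \<open>
  The first hypothesis implies \<open>|z| \<le> |z + d|\<close>. Since \<open>Re d \<ge> 0\<close>, it persists when \<open>z\<close> is replaced by
  \<open>z + k\<close>, so every factor of the quotient is at most 1 in modulus.
\<close>

lemma pochhammer_quot_le_1:
  fixes z d :: complex
  assumes "Re (cnj z * d) \<ge> 0" "Re d \<ge> 0"
  shows "norm (pochhammer z k / pochhammer (z + d) k) \<le> 1"
proof (induction k)
  case (Suc k)
  have "norm (z + of_nat k) \<le> norm (z + d + of_nat k)"
  proof (rule power2_le_imp_le)
    have "(norm (z + d + of_nat k))\<^sup>2 - (norm (z + of_nat k))\<^sup>2 =
        2 * Re (cnj z * d) + 2 * real k * Re d + (norm d)\<^sup>2"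
      by (simp add: cmod_power2) (simp add: power2_eq_square algebra_simps)
    moreover have "0 \<le> 2 * Re (cnj z * d) + 2 * real k * Re d + (norm d)\<^sup>2"
      using assms by (intro add_nonneg_nonneg mult_nonneg_nonneg) auto
    ultimately show "(norm (z + of_nat k))\<^sup>2 \<le> (norm (z + d + of_nat k))\<^sup>2"
      by linarith
  qed auto
  hence "norm ((z + of_nat k) / (z + d + of_nat k)) \<le> 1"
    by (simp add: norm_divide divide_le_eq_1)
  with Suc.IH have "norm (pochhammer z k / pochhammer (z + d) k) * norm ((z + of_nat k) / (z + d + of_nat k)) \<le> 1"
    by (intro mult_le_one) auto
  thus ?case
    by (simp add: pochhammer_Suc norm_mult norm_divide)
qed auto

lemma pochhammer_quot_tendsto:
  fixes s d :: complex
  shows "(\<lambda>N. pochhammer (s + 2 * of_nat N) k / pochhammer (s + 2 * of_nat N + d) k) \<longlonglongrightarrow> 1"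
proof (induction k)
  case (Suc k)
  have lin: "filterlim (\<lambda>N. s + of_nat k + d + 2 * of_nat N :: complex) at_infinity sequentially"
    by (intro tendsto_add_filterlim_at_infinity[OF tendsto_const]
          tendsto_mult_filterlim_at_infinity[OF tendsto_const] tendsto_of_nat) auto
  have "(\<lambda>N. 1 - d / (s + of_nat k + d + 2 * of_nat N)) \<longlonglongrightarrow> 1 - 0"
    by (intro tendsto_diff tendsto_const tendsto_divide_0[OF tendsto_const lin])
  moreover have "\<forall>\<^sub>F N in sequentially. 1 - d / (s + of_nat k + d + 2 * of_nat N) =
      (s + 2 * of_nat N + of_nat k) / (s + 2 * of_nat N + d + of_nat k)"
    using filterlim_at_infinity_imp_eventually_ne[OF lin, of 0]
    by eventually_elim (simp add: divide_simps add_ac)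
  ultimately have "(\<lambda>N. (s + 2 * of_nat N + of_nat k) / (s + 2 * of_nat N + d + of_nat k)) \<longlonglongrightarrow> 1 - 0"
    by (rule Lim_transform_eventually)
  from tendsto_mult[OF Suc.IH this] show ?case
    by (simp add: pochhammer_Suc)
qed auto

lemma gbinomial_beta_moment_bound:
  "\<exists>D. \<forall>k. norm ((\<nu> gchoose k) * beta_moment \<nu> s k) \<le> D * real (Suc k) powr (- 2 * Re \<nu> - 2)"
proof -
  obtain C D where C: "\<And>k. norm (\<nu> gchoose k) \<le> C * real (Suc k) powr (- Re \<nu> - 1)"
    and D: "\<And>k. norm (beta_moment \<nu> s k) \<le> D * real (Suc k) powr (- Re \<nu> - 1)"
    using gbinomial_powr_bound beta_moment_powr_bound by blast
  have C0: "C \<ge> 0" using order.trans[OF norm_ge_zero C[of 0]] by simp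
  have "norm ((\<nu> gchoose k) * beta_moment \<nu> s k) \<le> (C * D) * real (Suc k) powr (- 2 * Re \<nu> - 2)" for k
  proof -
    have "norm ((\<nu> gchoose k) * beta_moment \<nu> s k) \<le>
        (C * real (Suc k) powr (- Re \<nu> - 1)) * (D * real (Suc k) powr (- Re \<nu> - 1))"
      unfolding norm_mult using C0 by (intro mult_mono C D) auto
    also have "\<dots> = (C * D) * (real (Suc k) powr (- Re \<nu> - 1) * real (Suc k) powr (- Re \<nu> - 1))"
      by (simp only: mult_ac)
    also have "real (Suc k) powr (- Re \<nu> - 1) * real (Suc k) powr (- Re \<nu> - 1) = real (Suc k) powr (- 2 * Re \<nu> - 2)"
      unfolding powr_add [symmetric] by (rule arg_cong) simp
    finally show ?thesis .
  qed
  thus ?thesis by blast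
qed

lemma gbinomial_beta_moment_null:
  assumes "Re \<nu> > -1"
  shows "(\<lambda>k. (\<nu> gchoose k) * beta_moment \<nu> s k) \<longlonglongrightarrow> 0"
proof -
  obtain D where D: "\<And>k. norm ((\<nu> gchoose k) * beta_moment \<nu> s k) \<le> D * real (Suc k) powr (- 2 * Re \<nu> - 2)"
    using gbinomial_beta_moment_bound by blast
  have "p < 0 \<Longrightarrow> (\<lambda>k. D * real (Suc k) powr p) \<longlonglongrightarrow> 0" for p :: real
    by real_asymp
  from this[of "- 2 * Re \<nu> - 2"] show ?thesis
    by (rule Lim_null_comparison[OF always_eventually, rotated]) (use D assms in auto)
qed

lemma kummer_summable:
  assumes "Re \<nu> > 0"
  shows "summable (\<lambda>k. (\<nu> gchoose k) * beta_moment \<nu> s k)"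
proof -
  obtain D where D: "\<And>k. norm ((\<nu> gchoose k) * beta_moment \<nu> s k) \<le> D * real (Suc k) powr (- 2 * Re \<nu> - 2)"
    using gbinomial_beta_moment_bound by blast
  show ?thesis
    by (rule summable_comparison_test'[OF summable_mult[OF summable_Suc_powr]]) (use D assms in auto)
qed

text \<open>
  The two telescoping relations share their left-hand side, so eliminating it connects the
  parameters \<open>s\<close> and \<open>s + 2\<close> at the same exponent \<open>\<nu>\<close>.
\<close>

lemma kummer_recurrence:
  assumes "Re \<nu> > 0"
  shows "(\<Sum>k. (\<nu> gchoose k) * beta_moment \<nu> s k) =
    2 * (s + 1) * (\<nu> + 1 + s / 2) * (\<Sum>k. (\<nu> gchoose k) * beta_moment \<nu> (s + 2) k)"
proof (rule LIMSEQ_unique)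
  let ?f = "\<lambda>s k. (\<nu> gchoose k) * beta_moment \<nu> s k"
  have null: "(\<lambda>N. ?f s N) \<longlonglongrightarrow> 0" for s
    using assms by (intro gbinomial_beta_moment_null) auto
  have eq: "(\<nu> gchoose N) * beta_moment \<nu> s (Suc N) / 2 = s / 2 * ?f (s + 1) N" for N
    by (simp add: beta_moment_Suc)
  have "(\<lambda>N. (\<Sum>k\<le>N. ?f s k) - (\<nu> gchoose N) * beta_moment \<nu> s (Suc N) / 2) \<longlonglongrightarrow> (\<Sum>k. ?f s k) - s / 2 * 0"
    unfolding eq by (intro tendsto_intros summable_LIMSEQ' kummer_summable assms null)
  thus "(\<lambda>N. (\<nu> + 1 + s / 2) * (\<Sum>k\<le>N. ((\<nu> + 1) gchoose k) * beta_moment (\<nu> + 1) s k)) \<longlonglongrightarrow> (\<Sum>k. ?f s k)"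
    unfolding kummer_telescope_exponent by simp
  have "(\<lambda>N. (\<nu> + 1 + s / 2) * (2 * (s + 1) * (\<Sum>k<N. ?f (s + 2) k) + ?f (s + 1) N)) \<longlonglongrightarrow>
      (\<nu> + 1 + s / 2) * (2 * (s + 1) * (\<Sum>k. ?f (s + 2) k) + 0)"
    by (intro tendsto_intros summable_LIMSEQ kummer_summable assms null)
  thus "(\<lambda>N. (\<nu> + 1 + s / 2) * (\<Sum>k\<le>N. ((\<nu> + 1) gchoose k) * beta_moment (\<nu> + 1) s k)) \<longlonglongrightarrow>
      2 * (s + 1) * (\<nu> + 1 + s / 2) * (\<Sum>k. (\<nu> gchoose k) * beta_moment \<nu> (s + 2) k)"
    unfolding kummer_telescope_parameter by (simp add: mult_ac)
qed

lemma sq_moment_0_recurrence: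
  "sq_moment \<nu> s 0 = 2 * (s + 1) * (\<nu> + 1 + s / 2) * sq_moment \<nu> (s + 2) 0"
proof -
  have "rGamma (s / 2 + \<nu> + 1) = (s / 2 + \<nu> + 1) * rGamma ((s + 2) / 2 + \<nu> + 1)"
    by (rule rGamma_step) (simp add: add_divide_distrib)
  thus ?thesis
    using half_Gamma_quot_shift[of s] by (simp add: sq_moment_def mult_ac add_ac)
qed

text \<open>
  The condition on the sums makes the powers of \<open>N\<close> in \<open>rGamma_shift_asymp\<close> cancel.
\<close>

lemma rGamma_quot_tendsto_1:
  fixes a b c d :: complex
  assumes "a + b = c + d"
  shows "(\<lambda>N. (rGamma (a + of_nat N) * rGamma (b + of_nat N)) /
              (rGamma (c + of_nat N) * rGamma (d + of_nat N))) \<longlonglongrightarrow> 1"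
proof (rule Lim_transform_eventually)
  let ?g = "\<lambda>c N. rGamma (c + of_nat N) * fact N * of_nat N powr (c - 1) :: complex"
  have "(\<lambda>N. (?g a N * ?g b N) / (?g c N * ?g d N)) \<longlonglongrightarrow> (1 * 1) / (1 * 1)"
    by (intro tendsto_intros rGamma_shift_asymp) auto
  thus "(\<lambda>N. (?g a N * ?g b N) / (?g c N * ?g d N)) \<longlonglongrightarrow> 1"
    by simp
  show "\<forall>\<^sub>F N in sequentially. (?g a N * ?g b N) / (?g c N * ?g d N) =
      (rGamma (a + of_nat N) * rGamma (b + of_nat N)) / (rGamma (c + of_nat N) * rGamma (d + of_nat N))"
    using eventually_gt_at_top[of 0]
  proof eventually_elim
    case (elim N)
    define u where "u = fact N * fact N * (of_nat N powr (a - 1) * of_nat N powr (b - 1) :: complex)"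
    \<comment> \<open>The powers of \<open>N\<close> agree because the exponents have the same sum.\<close>
    have "of_nat N powr (a - 1) * of_nat N powr (b - 1) = (of_nat N powr (c - 1) * of_nat N powr (d - 1) :: complex)"
      unfolding powr_add [symmetric] using assms by (intro arg_cong[where f = "\<lambda>t. of_nat N powr t"]) (simp add: algebra_simps)
    hence u': "u = fact N * fact N * (of_nat N powr (c - 1) * of_nat N powr (d - 1))"
      by (simp add: u_def)
    have "u \<noteq> 0"
      using elim by (simp add: u_def)
    have ab: "?g a N * ?g b N = u * (rGamma (a + of_nat N) * rGamma (b + of_nat N))"
      unfolding u_def by (simp only: mult_ac)
    have cd: "?g c N * ?g d N = u * (rGamma (c + of_nat N) * rGamma (d + of_nat N))"
      unfolding u' by (simp only: mult_ac)
    show ?case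
      unfolding ab cd using \<open>u \<noteq> 0\<close> by (rule mult_divide_mult_cancel_left)
  qed
qed

lemma rGamma_eventually_nonzero:
  fixes c :: complex
  shows "\<forall>\<^sub>F N in sequentially. rGamma (c + 2 * of_nat N) \<noteq> 0"
proof -
  obtain N0 :: nat where N0: "- Re c < real N0"
    using reals_Archimedean2 by blast
  have "rGamma (c + 2 * of_nat N) \<noteq> 0" if "N \<ge> N0" for N
  proof
    assume "rGamma (c + 2 * of_nat N) = 0"
    then obtain n where "c + 2 * of_nat N = - of_nat n"
      by (auto simp: rGamma_eq_zero_iff elim!: nonpos_Ints_cases')
    hence "Re (c + 2 * of_nat N) = Re (- of_nat n)"
      by simp
    thus False
      using N0 that by simp
  qed
  thus ?thesis
    by (auto simp: eventually_sequentially)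
qed

text \<open>
  As the parameter tends to infinity, every quotient tends to 1, and the series becomes the
  binomial series of \<open>(1 + 1)^\<nu>\<close>. Terms are dominated because the quotients are bounded by 1 once the
  real part of the parameter exceeds a constant.
\<close>

lemma kummer_normalised_limit:
  assumes "Re \<nu> > 0"
  shows "(\<lambda>N. \<Sum>k. (\<nu> gchoose k) * (pochhammer (s + 2 * of_nat N) k / pochhammer (s + 2 * of_nat N + (\<nu> + 1)) k))
           \<longlonglongrightarrow> 2 powr \<nu>"
proof -
  obtain N0 :: nat where N0: "(\<bar>Re s\<bar> + \<bar>Im s * Im \<nu>\<bar>) < real N0"
    using reals_Archimedean2 by blast
  have "norm ((\<nu> gchoose k) * (pochhammer (s + 2 * of_nat N) k / pochhammer (s + 2 * of_nat N + (\<nu> + 1)) k))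
      \<le> norm (\<nu> gchoose k)" if "N \<ge> N0" for N k
  proof -
    have "\<bar>Im s * Im \<nu>\<bar> \<le> (Re s + 2 * real N) * 1"
      using N0 that by simp
    also have "\<dots> \<le> (Re s + 2 * real N) * (Re \<nu> + 1)"
      using N0 that assms by (intro mult_left_mono) auto
    finally have "Re (cnj (s + 2 * of_nat N) * (\<nu> + 1)) \<ge> 0"
      by simp
    from pochhammer_quot_le_1[OF this, of k] assms show ?thesis
      unfolding norm_mult by (intro mult_left_le) auto
  qed
  hence dom: "\<forall>\<^sub>F N in sequentially. \<forall>k. norm ((\<nu> gchoose k) *
      (pochhammer (s + 2 * of_nat N) k / pochhammer (s + 2 * of_nat N + (\<nu> + 1)) k)) \<le> norm (\<nu> gchoose k)"
    by (auto simp: eventually_sequentially)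
  have lim: "(\<lambda>N. (\<nu> gchoose k) *
      (pochhammer (s + 2 * of_nat N) k / pochhammer (s + 2 * of_nat N + (\<nu> + 1)) k)) \<longlonglongrightarrow> (\<nu> gchoose k)" for k
    using tendsto_mult[OF tendsto_const pochhammer_quot_tendsto, of "\<nu> gchoose k" s k "\<nu> + 1"] by simp
  show ?thesis
    using tannery(2)[OF dom binomial_sum_at_1(2)[OF assms] lim]
    unfolding binomial_sum_at_1(1)[OF assms] .
qed

text \<open>
  Both sides satisfy the same recurrence in \<open>s\<close>, so they are the same multiple of their values at
  \<open>s + 2 N\<close>. For large \<open>N\<close> the sum is \<open>2^\<nu> / \<Gamma>(s + 2 N + \<nu> + 1)\<close> to leading order, and so is the
  right-hand side, by the duplication formula.
\<close>

lemma kummer_pos: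
  assumes "Re \<nu> > 0"
  shows "(\<lambda>k. (\<nu> gchoose k) * beta_moment \<nu> s k) sums sq_moment \<nu> s 0"
proof -
  define K where "K = (\<lambda>s. \<Sum>k. (\<nu> gchoose k) * beta_moment \<nu> s k)"
  define F where "F = (\<lambda>N. \<Sum>k. (\<nu> gchoose k) * (pochhammer (s + 2 * of_nat N) k / pochhammer (s + 2 * of_nat N + (\<nu> + 1)) k))"
  define Q where "Q = (\<lambda>N::nat. (rGamma ((s + 1) / 2 + of_nat N) * rGamma (s / 2 + \<nu> + 1 + of_nat N)) /
              (rGamma ((s + \<nu> + 2) / 2 + of_nat N) * rGamma ((s + \<nu> + 1) / 2 + of_nat N)))"
  define R where "R = (\<lambda>N. \<Prod>j<N. 2 * (s + 2 * of_nat j + 1) * (\<nu> + 1 + (s + 2 * of_nat j) / 2))"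
  \<comment> \<open>\<open>R N\<close> is the product of \<open>N\<close> factors of the common recurrence.\<close>
  have iterate: "X s = R N * X (s + 2 * of_nat N)"
    if "\<And>s. X s = 2 * (s + 1) * (\<nu> + 1 + s / 2) * X (s + 2)" for X N
  proof (induction N)
    case (Suc N)
    have "X (s + 2 * of_nat N) = 2 * (s + 2 * of_nat N + 1) * (\<nu> + 1 + (s + 2 * of_nat N) / 2) * X (s + 2 * of_nat (Suc N))"
      using that[of "s + 2 * of_nat N"] by (simp add: add_ac)
    with Suc.IH show ?case
      by (simp only: R_def prod.lessThan_Suc mult.assoc)
  qed (simp add: R_def)
  have KR: "K s = R N * K (s + 2 * of_nat N)" for N
    by (rule iterate) (unfold K_def, rule kummer_recurrence[OF assms])
  have MR: "sq_moment \<nu> s 0 = R N * sq_moment \<nu> (s + 2 * of_nat N) 0" for N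
    by (rule iterate) (rule sq_moment_0_recurrence)
  have Q: "Q \<longlonglongrightarrow> 1"
    unfolding Q_def by (rule rGamma_quot_tendsto_1) (simp add: field_simps)
  have F: "F \<longlonglongrightarrow> 2 powr \<nu>"
    unfolding F_def by (rule kummer_normalised_limit[OF assms])
  \<comment> \<open>\<open>F N\<close> is the sum and \<open>2^\<nu> Q N\<close> the moment at \<open>s + 2 N\<close>, both multiplied by \<open>\<Gamma>(s + 2 N + \<nu> + 1)\<close>.\<close>
  have ev: "\<forall>\<^sub>F N in sequentially. sq_moment \<nu> s 0 * (F N / (2 powr \<nu> * Q N)) = K s"
    using rGamma_eventually_nonzero[of "s + \<nu> + 1"] tendsto_imp_eventually_ne[OF Q one_neq_zero]
  proof eventually_elim
    case (elim N)
    define \<sigma> where "\<sigma> = s + 2 * of_nat N"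
    have nz: "rGamma (\<sigma> + \<nu> + 1) \<noteq> 0"
      using elim by (simp add: \<sigma>_def add_ac)
    have "beta_moment \<nu> \<sigma> k = rGamma (\<sigma> + \<nu> + 1) * (pochhammer \<sigma> k / pochhammer (\<sigma> + (\<nu> + 1)) k)" for k
    proof -
      have "rGamma (\<sigma> + \<nu> + 1) = pochhammer (\<sigma> + \<nu> + 1) k * rGamma (\<sigma> + \<nu> + 1 + of_nat k)"
        by (rule pochhammer_rGamma)
      with nz show ?thesis
        by (auto simp: beta_moment_def add.assoc)
    qed
    hence "K \<sigma> = (\<Sum>k. rGamma (\<sigma> + \<nu> + 1) * ((\<nu> gchoose k) * (pochhammer \<sigma> k / pochhammer (\<sigma> + (\<nu> + 1)) k)))"
      unfolding K_def by (simp only: mult_ac)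
    also have "\<dots> = rGamma (\<sigma> + \<nu> + 1) * F N"
    proof (unfold F_def \<sigma>_def [symmetric], rule suminf_mult)
      have "summable (\<lambda>k. (1 / rGamma (\<sigma> + \<nu> + 1)) * ((\<nu> gchoose k) * beta_moment \<nu> \<sigma> k))"
        by (intro summable_mult kummer_summable assms)
      thus "summable (\<lambda>k. (\<nu> gchoose k) * (pochhammer \<sigma> k / pochhammer (\<sigma> + (\<nu> + 1)) k))"
        using \<open>\<And>k. beta_moment \<nu> \<sigma> k = _ k\<close> nz by simp
    qed
    finally have K: "K \<sigma> = rGamma (\<sigma> + \<nu> + 1) * F N" .
    define A B C D where "A = rGamma ((\<sigma> + 1) / 2)" and "B = rGamma (\<sigma> / 2 + \<nu> + 1)"
      and "C = rGamma ((\<sigma> + \<nu> + 1 + 1) / 2)" and "D = rGamma ((\<sigma> + \<nu> + 1) / 2)"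
    have "(\<sigma> + \<nu> + 1 + 1) / 2 = (s + \<nu> + 2) / 2 + of_nat N" "(\<sigma> + \<nu> + 1) / 2 = (s + \<nu> + 1) / 2 + of_nat N"
        "(\<sigma> + 1) / 2 = (s + 1) / 2 + of_nat N" "\<sigma> / 2 + \<nu> + 1 = s / 2 + \<nu> + 1 + of_nat N"
      by (auto simp: \<sigma>_def field_simps)
    hence QN: "Q N = (A * B) / (C * D)"
      by (simp only: Q_def A_def B_def C_def D_def)
    have "- (\<sigma> + \<nu> + 1) = - \<sigma> - \<nu> - 1" by simp
    hence "2 powr (- (\<sigma> + \<nu> + 1)) = (2 powr (- \<sigma>) / 2 powr \<nu> / 2 :: complex)"
      by (simp only: powr_diff) simp
    hence "rGamma (\<sigma> + \<nu> + 1) = of_real (sqrt pi) * (2 powr (- \<sigma>) / 2 powr \<nu> / 2) * C * D * 2"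
      using half_Gamma_quot_rGamma[of "\<sigma> + \<nu> + 1"] unfolding half_Gamma_quot_def C_def D_def by simp
    moreover have "C \<noteq> 0" "D \<noteq> 0"
      using elim(2) unfolding QN by auto
    ultimately have "of_real (sqrt pi) * 2 powr (- \<sigma>) * A * B = 2 powr \<nu> * Q N * rGamma (\<sigma> + \<nu> + 1)"
      unfolding QN by simp
    hence M: "sq_moment \<nu> \<sigma> 0 = 2 powr \<nu> * Q N * rGamma (\<sigma> + \<nu> + 1)"
      by (simp add: sq_moment_def half_Gamma_quot_def A_def B_def)
    have "sq_moment \<nu> s 0 * (F N / (2 powr \<nu> * Q N)) = R N * (rGamma (\<sigma> + \<nu> + 1) * F N)"
      using elim(2) by (simp add: MR[of N, folded \<sigma>_def] M)
    also have "\<dots> = K s"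
      using KR[of N, folded \<sigma>_def] by (simp only: K)
    finally show ?case .
  qed
  have "(\<lambda>N. sq_moment \<nu> s 0 * (F N / (2 powr \<nu> * Q N))) \<longlonglongrightarrow> sq_moment \<nu> s 0 * (2 powr \<nu> / (2 powr \<nu> * 1))"
    by (intro tendsto_intros F Q) auto
  from Lim_transform_eventually[OF this ev] have "K s = sq_moment \<nu> s 0"
    by (simp add: LIMSEQ_const_iff)
  thus ?thesis
    using kummer_summable[OF assms] by (auto simp: K_def sums_iff)
qed

lemma kummer_descend:
  assumes "(\<lambda>k. ((\<nu> + 1) gchoose k) * beta_moment (\<nu> + 1) s k) sums sq_moment (\<nu> + 1) s 0"
    and null: "(\<lambda>N. (\<nu> gchoose N) * beta_moment \<nu> s (Suc N)) \<longlonglongrightarrow> 0"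
  shows "(\<lambda>k. (\<nu> gchoose k) * beta_moment \<nu> s k) sums sq_moment \<nu> s 0"
proof -
  have "(\<Sum>k\<le>N. (\<nu> gchoose k) * beta_moment \<nu> s k) =
      (\<nu> + 1 + s / 2) * (\<Sum>k\<le>N. ((\<nu> + 1) gchoose k) * beta_moment (\<nu> + 1) s k) +
      (\<nu> gchoose N) * beta_moment \<nu> s (Suc N) / 2" for N
    unfolding kummer_telescope_exponent by simp
  moreover have "(\<lambda>N. (\<nu> + 1 + s / 2) * (\<Sum>k\<le>N. ((\<nu> + 1) gchoose k) * beta_moment (\<nu> + 1) s k) +
      (\<nu> gchoose N) * beta_moment \<nu> s (Suc N) / 2) \<longlonglongrightarrow> (\<nu> + 1 + s / 2) * sq_moment (\<nu> + 1) s 0 + 0 / 2"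
    using assms unfolding sums_def_le by (intro tendsto_intros) auto
  moreover have "(\<nu> + 1 + s / 2) * sq_moment (\<nu> + 1) s 0 = sq_moment \<nu> s 0"
  proof -
    have "rGamma (s / 2 + \<nu> + 1) = (s / 2 + \<nu> + 1) * rGamma (s / 2 + (\<nu> + 1) + 1)"
      by (rule rGamma_step) simp
    thus ?thesis
      by (simp add: sq_moment_def add_ac)
  qed
  ultimately show ?thesis
    by (simp add: sums_def_le)
qed

lemma beta_moment_terminates: "k > m \<Longrightarrow> beta_moment \<nu> (- of_nat m) k = 0"
  by (simp add: beta_moment_def pochhammer_of_nat_eq_0_lemma)

text \<open>
  Kummer's summation formula. The telescoping relation carries it from \<open>Re \<nu> > 0\<close> one step down, to
  \<open>Re \<nu> > -1\<close>, where its remainder still tends to 0. If \<open>-s\<close> is a natural number, the remainder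
  vanishes eventually and there is no limit to the number of steps.
\<close>

theorem kummer:
  assumes "Re \<nu> > -1 \<or> (\<exists>m. s = - of_nat m)"
  shows "(\<lambda>k. (\<nu> gchoose k) * beta_moment \<nu> s k) sums sq_moment \<nu> s 0"
  using assms
proof
  assume \<nu>: "Re \<nu> > -1"
  have "(\<lambda>N. (\<nu> gchoose N) * beta_moment \<nu> s (Suc N)) = (\<lambda>N. s * ((\<nu> gchoose N) * beta_moment \<nu> (s + 1) N))"
    by (simp add: beta_moment_Suc mult_ac)
  moreover have "(\<lambda>N. s * ((\<nu> gchoose N) * beta_moment \<nu> (s + 1) N)) \<longlonglongrightarrow> s * 0"
    by (intro tendsto_intros gbinomial_beta_moment_null \<nu>)
  ultimately show ?thesis
    using \<nu> by (intro kummer_descend[OF kummer_pos]) auto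
next
  assume "\<exists>m. s = - of_nat m"
  then obtain m where m: "s = - of_nat m" by blast
  obtain j :: nat where "- Re \<nu> < real j"
    using reals_Archimedean2 by blast
  thus ?thesis
  proof (induction j arbitrary: \<nu>)
    case 0
    thus ?case by (intro kummer_pos) auto
  next
    case (Suc j)
    have "\<forall>\<^sub>F N in sequentially. (\<nu> gchoose N) * beta_moment \<nu> s (Suc N) = 0"
      using eventually_ge_at_top[of m] by eventually_elim (simp add: m beta_moment_terminates)
    hence "(\<lambda>N. (\<nu> gchoose N) * beta_moment \<nu> s (Suc N)) \<longlonglongrightarrow> 0"
      by (rule tendsto_eventually)
    thus ?case
      using Suc.prems by (intro kummer_descend[OF Suc.IH]) auto
  qed
qed

section \<open>The inverse of Kummer's theorem\<close>

lemma fps_binomial_inverse_nth: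
  "(\<Sum>k\<le>n. (- \<nu> gchoose k) * (\<nu> gchoose (n - k))) = (if n = 0 then 1 else 0)" for \<nu> :: complex
proof -
  have "fps_binomial (- \<nu>) * fps_binomial \<nu> = 1"
    using fps_binomial_add_mult[of "- \<nu>" \<nu>] by simp
  from arg_cong[OF this, of "\<lambda>f. fps_nth f n"] show ?thesis
    by (simp add: fps_mult_nth atLeast0AtMost)
qed

text \<open>
  \<open>B 1 = B ((1 + v)^\<nu> (1 + v)^(-\<nu>)) = D ((1 + v)^(-\<nu>))\<close>, where the second step is Kummer's theorem.
  For \<open>Re \<nu> > 0\<close> the double series converges absolutely.
\<close>

lemma inverse_kummer_pos:
  assumes "Re \<nu> > 0"
  shows "(\<lambda>n. (- \<nu> gchoose n) * sq_moment \<nu> s n) sums rGamma (s + \<nu> + 1)"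
proof -
  obtain B C D where B: "\<And>k. norm (- \<nu> gchoose k) \<le> B * real (Suc k) powr (Re \<nu> - 1)"
    and C: "\<And>k. norm (\<nu> gchoose k) \<le> C * real (Suc k) powr (- Re \<nu> - 1)"
    and D: "\<And>k. norm (beta_moment \<nu> s k) \<le> D * real (Suc k) powr (- Re \<nu> - 1)"
    using gbinomial_powr_bound[of "- \<nu>"] gbinomial_powr_bound[of \<nu>] beta_moment_powr_bound[of \<nu> s] by auto
  have D0: "D \<ge> 0" using order.trans[OF norm_ge_zero D[of 0]] by simp
  have smC: "summable (\<lambda>n. norm (\<nu> gchoose n))"
    by (rule binomial_sum_at_1(2)[OF assms])
  define E where "E = suminf (\<lambda>n. norm (\<nu> gchoose n)) * D"
  define \<rho> where "\<rho> = (\<lambda>k. E * real (Suc k) powr (- Re \<nu> - 1))"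
  have E0: "E \<ge> 0"
    unfolding E_def using D0 by (intro mult_nonneg_nonneg suminf_nonneg smC) auto
  have sq: "(\<lambda>n. (\<nu> gchoose n) * beta_moment \<nu> s (n + k)) sums sq_moment \<nu> s k" for k
  proof -
    have "(\<lambda>n. pochhammer s k * ((\<nu> gchoose n) * beta_moment \<nu> (s + of_nat k) n)) sums
        (pochhammer s k * sq_moment \<nu> (s + of_nat k) 0)"
      by (intro sums_mult kummer_pos assms)
    thus ?thesis
      using beta_moment_add[of \<nu> s k] sq_moment_add[of \<nu> s k 0] by (simp add: mult_ac add.commute)
  qed
  have bd: "norm (\<Sum>n<N. (\<nu> gchoose n) * beta_moment \<nu> s (n + k)) \<le> \<rho> k" for k N
  proof -
    have "norm (\<Sum>n<N. (\<nu> gchoose n) * beta_moment \<nu> s (n + k)) \<le>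
        (\<Sum>n<N. norm (\<nu> gchoose n) * (D * real (Suc k) powr (- Re \<nu> - 1)))"
    proof (rule order.trans[OF norm_sum sum_mono])
      fix n
      have "norm (beta_moment \<nu> s (n + k)) \<le> D * real (Suc (n + k)) powr (- Re \<nu> - 1)"
        by (rule D)
      also have "\<dots> \<le> D * real (Suc k) powr (- Re \<nu> - 1)"
        using assms D0 by (intro mult_left_mono powr_mono2') auto
      finally show "norm ((\<nu> gchoose n) * beta_moment \<nu> s (n + k)) \<le>
          norm (\<nu> gchoose n) * (D * real (Suc k) powr (- Re \<nu> - 1))"
        unfolding norm_mult by (rule mult_left_mono) auto
    qed
    also have "\<dots> \<le> suminf (\<lambda>n. norm (\<nu> gchoose n)) * (D * real (Suc k) powr (- Re \<nu> - 1))"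
      unfolding sum_distrib_right [symmetric] using D0 by (intro mult_right_mono sum_le_suminf smC) auto
    finally show ?thesis
      by (simp add: \<rho>_def E_def mult_ac)
  qed
  have sm: "summable (\<lambda>k. norm (- \<nu> gchoose k) * \<rho> k)"
  proof (rule summable_comparison_test'[OF summable_mult[OF summable_Suc_powr]])
    fix k
    have "norm (- \<nu> gchoose k) * \<rho> k \<le> (B * real (Suc k) powr (Re \<nu> - 1)) * \<rho> k"
      unfolding \<rho>_def using E0 by (intro mult_right_mono B) auto
    also have "\<dots> = B * E * (real (Suc k) powr (Re \<nu> - 1) * real (Suc k) powr (- Re \<nu> - 1))"
      by (simp only: \<rho>_def mult_ac)
    also have "real (Suc k) powr (Re \<nu> - 1) * real (Suc k) powr (- Re \<nu> - 1) = real (Suc k) powr (-2)"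
      unfolding powr_add [symmetric] by (rule arg_cong) simp
    finally show "norm (norm (- \<nu> gchoose k) * \<rho> k) \<le> (B * E) * real (Suc k) powr (-2)"
      using E0 by (simp add: \<rho>_def)
  qed simp
  note mr = moment_rearrangement[OF sq bd sm]
  have "(\<lambda>n. (\<Sum>k\<le>n. (- \<nu> gchoose k) * (\<nu> gchoose (n - k))) * beta_moment \<nu> s n) sums beta_moment \<nu> s 0"
    unfolding fps_binomial_inverse_nth
    using sums_single[of 0 "beta_moment \<nu> s"] by (simp add: if_distrib[of "\<lambda>x. x * _"] cong: if_cong)
  hence "beta_moment \<nu> s 0 = (\<Sum>k. (- \<nu> gchoose k) * sq_moment \<nu> s k)"
    using mr(2) by (rule sums_unique2)
  thus ?thesis
    using mr(1) by (simp add: sums_iff beta_moment_def)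
qed

text \<open>
  Both sides represent \<open>1 / \<Gamma>(s + \<nu> + 2)\<close> in the limit. Moments whose
  indices differ by an odd number are not rationally related. In the induction step the moment of
  index \<open>N + 1\<close> for the parameter \<open>s + 1\<close> therefore has to cancel, and the others are polynomial
  multiples of one quantity \<open>P\<close>.
\<close>

lemma inverse_kummer_telescope:
  fixes \<nu> s :: complex
  shows "(\<Sum>n\<le>N. (- (\<nu> + 1) gchoose n) * sq_moment (\<nu> + 1) s n) =
     (\<Sum>n\<le>N. (- \<nu> gchoose n) * sq_moment \<nu> (s + 1) n) +
     (- (\<nu> + 2) gchoose N) * (sq_moment \<nu> (s + 1) (Suc N) - sq_moment \<nu> (s + 1) N) +
     (- (\<nu> + 1) gchoose N) * sq_moment \<nu> (s + 1) (Suc N)"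
proof (induction N)
  case 0
  have "rGamma (s / 2 + (\<nu> + 1) + 1) = rGamma ((s + 1 + 1) / 2 + \<nu> + 1)"
    by (rule arg_cong) (simp add: add_divide_distrib)
  hence "sq_moment (\<nu> + 1) s 0 = 2 * sq_moment \<nu> (s + 1) (Suc 0)"
    using half_Gamma_quot_shift[of s] by (simp add: sq_moment_def add_ac mult_ac)
  thus ?case by simp
next
  case (Suc N)
  let ?c0 = "- (\<nu> + 2) gchoose N" and ?c1 = "- (\<nu> + 2) gchoose Suc N"
  let ?b0 = "- (\<nu> + 1) gchoose N" and ?b1 = "- (\<nu> + 1) gchoose Suc N"
  let ?a1 = "- \<nu> gchoose Suc N"
  let ?u = "sq_moment \<nu> (s + 1)"
  define w where "w = s + 1 + of_nat N"
  define P where "P = pochhammer (s + 1) N * half_Gamma_quot w * rGamma (w / 2 + \<nu> + 2)"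
  have a1: "?a1 = ?b1 + ?b0"
    using gbinomial_Suc_Suc[of "- (\<nu> + 1)" N] by (simp add: add.commute)
  have b1: "?b1 = ?c1 + ?c0"
    using gbinomial_Suc_Suc[of "- (\<nu> + 2)" N] by (simp add: add.commute)
  have c1: "of_nat (Suc N) * ?c1 = (- (\<nu> + 2) - of_nat N) * ?c0"
    by (rule gbinomial_Suc_times)
  have u0: "?u N = (w / 2 + \<nu> + 1) * P"
  proof -
    have "rGamma (w / 2 + \<nu> + 1) = (w / 2 + \<nu> + 1) * rGamma (w / 2 + \<nu> + 2)"
      by (rule rGamma_step) simp
    thus ?thesis
      unfolding sq_moment_def P_def w_def [symmetric] by (simp only: mult_ac)
  qed
  have u2: "?u (Suc (Suc N)) = w / 2 * P"
  proof -
    have e: "s + 1 + of_nat (Suc (Suc N)) = w + 2" "(w + 2) / 2 + \<nu> + 1 = w / 2 + \<nu> + 2"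
      "s + 1 + of_nat (Suc N) = w + 1" "s + 1 + of_nat N = w"
      by (auto simp: w_def add_divide_distrib)
    show ?thesis
      unfolding sq_moment_def P_def pochhammer_Suc e half_Gamma_quot_shift[of w] by simp
  qed
  have m: "sq_moment (\<nu> + 1) s (Suc N) = s * P"
  proof -
    have e: "s + of_nat (Suc N) = w" "w / 2 + (\<nu> + 1) + 1 = w / 2 + \<nu> + 2"
      by (auto simp: w_def)
    show ?thesis
      unfolding sq_moment_def P_def pochhammer_rec e by (simp only: mult_ac)
  qed
  have "(2 * ?c1 + ?c0) * (w / 2) + ?c0 * (w / 2 + \<nu> + 1) = ?c1 * w + ?c0 * (w + \<nu> + 1)"
    by (simp add: field_simps)
  also have "\<dots> = s * (?c1 + ?c0) + (of_nat (Suc N) * ?c1 - (- (\<nu> + 2) - of_nat N) * ?c0)"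
    by (simp add: w_def algebra_simps)
  also have "\<dots> = s * (?c1 + ?c0)"
    unfolding c1 by simp
  finally have "s * (?c1 + ?c0) = (2 * ?c1 + ?c0) * (w / 2) + ?c0 * (w / 2 + \<nu> + 1)" ..
  hence "(?c1 + ?c0) * (s * P) = (2 * ?c1 + ?c0) * (w / 2 * P) + ?c0 * ((w / 2 + \<nu> + 1) * P)"
    by algebra
  hence key: "?b1 * sq_moment (\<nu> + 1) s (Suc N) = (2 * ?c1 + ?c0) * ?u (Suc (Suc N)) + ?c0 * ?u N"
    unfolding b1 u0 u2 m .
  show ?case
    unfolding sum.atMost_Suc Suc.IH key
    unfolding a1 b1 by (simp add: algebra_simps)
qed

text \<open>
  In contrast to Kummer's theorem there is no restriction on \<open>\<nu>\<close>: the terms are of order \<open>n^(-2)\<close>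
  throughout. The telescoping relation moves \<open>\<nu>\<close> down by 1 and \<open>s\<close> up by 1. The first part of its
  remainder is of order \<open>n^(\<nu>+1)\<close> times a difference of consecutive moments, which is of smaller
  order than the moments themselves.
\<close>

theorem inverse_kummer: "(\<lambda>n. (- \<nu> gchoose n) * sq_moment \<nu> s n) sums rGamma (s + \<nu> + 1)"
proof -
  obtain j :: nat where "- Re \<nu> < real j"
    using reals_Archimedean2 by blast
  thus ?thesis
  proof (induction j arbitrary: \<nu> s)
    case 0
    thus ?case by (intro inverse_kummer_pos) auto
  next
    case (Suc j)
    let ?u = "sq_moment \<nu> s"
    have u: "(\<lambda>n. ?u n * of_nat n powr (\<nu> + 1)) \<longlonglongrightarrow> 2 powr \<nu> * rGamma s"
      by (rule sq_moment_asymp)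
    \<comment> \<open>Consecutive moments agree to leading order, since \<open>n^(\<nu>+1)\<close> and \<open>(n+1)^(\<nu>+1)\<close> do.\<close>
    have ratio: "(\<lambda>n. (of_nat n / of_nat (Suc n)) powr (\<nu> + 1) :: complex) \<longlonglongrightarrow> 1"
    proof -
      have "(\<lambda>n. (of_nat n / of_nat (Suc n)) powr (\<nu> + 1) :: complex) \<longlonglongrightarrow> 1 powr (\<nu> + 1)"
        by (rule tendsto_powr_complex [OF _ LIMSEQ_n_over_Suc_n tendsto_const]) auto
      thus ?thesis by simp
    qed
    have uS: "(\<lambda>n. ?u (Suc n) * of_nat n powr (\<nu> + 1)) \<longlonglongrightarrow> 2 powr \<nu> * rGamma s"
    proof -
      have "(\<lambda>n. ?u (Suc n) * of_nat n powr (\<nu> + 1)) \<longlonglongrightarrow> (2 powr \<nu> * rGamma s) * 1"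
      proof (rule Lim_transform_eventually[OF tendsto_mult[OF LIMSEQ_Suc[OF u] ratio]])
        have "of_nat (Suc n) powr (\<nu> + 1) * (of_nat n / of_nat (Suc n)) powr (\<nu> + 1) =
            (of_nat n powr (\<nu> + 1) :: complex)" for n
        proof -
          have "(of_real (real n / real (Suc n)) * of_real (real (Suc n))) powr (\<nu> + 1) =
              of_real (real n / real (Suc n)) powr (\<nu> + 1) * of_real (real (Suc n)) powr (\<nu> + 1)"
            by (rule powr_times_real) auto
          moreover have "of_real (real n / real (Suc n)) * of_real (real (Suc n)) = (of_nat n :: complex)"
            unfolding of_real_mult [symmetric] by simp
          moreover have "of_real (real n / real (Suc n)) = (of_nat n / of_nat (Suc n) :: complex)"
            by (simp only: of_real_divide of_real_of_nat_eq)
          moreover have "of_real (real (Suc n)) = (of_nat (Suc n) :: complex)"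
            by (rule of_real_of_nat_eq)
          ultimately show ?thesis
            by (simp only: mult.commute[of "of_nat (Suc n) powr _"])
        qed
        thus "\<forall>\<^sub>F n in sequentially. ?u (Suc n) * of_nat (Suc n) powr (\<nu> + 1) * (of_nat n / of_nat (Suc n)) powr (\<nu> + 1) =
            ?u (Suc n) * of_nat n powr (\<nu> + 1)"
          by (intro always_eventually allI) (simp only: mult.assoc)
      qed
      thus ?thesis by simp
    qed
    have step: "(\<lambda>n. (?u (Suc n) - ?u n) * of_nat n powr (\<nu> + 1)) \<longlonglongrightarrow> 0"
    proof -
      from tendsto_diff[OF uS u] show ?thesis
        by (simp add: left_diff_distrib)
    qed
    \<comment> \<open>The coefficients of \<open>(1 + v)^a\<close> are of order \<open>n^(-a-1)\<close>.\<close>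
    have small: "(\<lambda>n. (a gchoose n) * v n) \<longlonglongrightarrow> 0"
      if "(\<lambda>n. v n * of_nat n powr c) \<longlonglongrightarrow> 0" "Re a + Re c + 1 \<ge> 0" for a c :: complex and v
    proof -
      obtain C where C: "\<And>n. norm (a gchoose n) \<le> C * real (Suc n) powr (- Re a - 1)"
        using gbinomial_powr_bound by blast
      have C0: "C \<ge> 0" using order.trans[OF norm_ge_zero C[of 0]] by simp
      have bound: "norm ((a gchoose n) * v n) \<le> C * 2 powr \<bar>Re c\<bar> * norm (v n * of_nat n powr c)"
        if "n > 0" for n
      proof -
        have "real (Suc n) powr (- Re a - 1) \<le> real (Suc n) powr Re c"
          using \<open>Re a + Re c + 1 \<ge> 0\<close> by (intro powr_mono) auto
        also have "\<dots> \<le> real n powr Re c * 2 powr \<bar>Re c\<bar>"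
          using powr_shift_le(1)[of "n - 1" 1 "Re c"] that by (simp add: numeral_2_eq_2)
        finally have "norm (a gchoose n) \<le> C * (real n powr Re c * 2 powr \<bar>Re c\<bar>)"
          using C[of n] C0 by (auto intro: order.trans mult_left_mono)
        from mult_right_mono[OF this, of "norm (v n)"] show ?thesis
          using that norm_powr_real_powr[of "of_nat n" c] by (simp add: norm_mult mult_ac)
      qed
      show ?thesis
      proof (rule Lim_null_comparison)
        show "\<forall>\<^sub>F n in sequentially. norm ((a gchoose n) * v n) \<le> C * 2 powr \<bar>Re c\<bar> * norm (v n * of_nat n powr c)"
          using eventually_gt_at_top[of 0] by eventually_elim (rule bound)
        show "(\<lambda>n. C * 2 powr \<bar>Re c\<bar> * norm (v n * of_nat n powr c)) \<longlonglongrightarrow> 0"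
          by (intro tendsto_mult_right_zero tendsto_norm_zero that)
      qed
    qed
    have r1: "(\<lambda>N. (- (\<nu> + 2) gchoose N) * (?u (Suc N) - ?u N)) \<longlonglongrightarrow> 0"
      by (rule small[OF step]) simp
    have r2: "(\<lambda>N. (- (\<nu> + 1) gchoose N) * ?u (Suc N)) \<longlonglongrightarrow> 0"
    proof (rule small[of _ \<nu>])
      have "(\<lambda>n. ?u (Suc n) * of_nat n powr (\<nu> + 1) * inverse (of_nat n)) \<longlonglongrightarrow> 2 powr \<nu> * rGamma s * 0"
        by (intro tendsto_mult uS lim_inverse_n)
      moreover have "\<forall>\<^sub>F n in sequentially. ?u (Suc n) * of_nat n powr (\<nu> + 1) * inverse (of_nat n) =
          ?u (Suc n) * of_nat n powr \<nu>"
        using eventually_gt_at_top[of 0] by eventually_elim (simp add: powr_add)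
      ultimately show "(\<lambda>n. ?u (Suc n) * of_nat n powr \<nu>) \<longlonglongrightarrow> 0"
        using Lim_transform_eventually by fastforce
    qed simp
    have "(\<Sum>n\<le>N. (- \<nu> gchoose n) * ?u n) = (\<Sum>n\<le>N. (- (\<nu> + 1) gchoose n) * sq_moment (\<nu> + 1) (s - 1) n)
        - (- (\<nu> + 2) gchoose N) * (?u (Suc N) - ?u N) - (- (\<nu> + 1) gchoose N) * ?u (Suc N)" for N
      unfolding inverse_kummer_telescope by simp
    moreover have "(\<lambda>n. (- (\<nu> + 1) gchoose n) * sq_moment (\<nu> + 1) (s - 1) n) sums rGamma (s - 1 + (\<nu> + 1) + 1)"
      using Suc.prems by (intro Suc.IH) simp
    hence "(\<lambda>N. (\<Sum>n\<le>N. (- (\<nu> + 1) gchoose n) * sq_moment (\<nu> + 1) (s - 1) n)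
        - (- (\<nu> + 2) gchoose N) * (?u (Suc N) - ?u N) - (- (\<nu> + 1) gchoose N) * ?u (Suc N))
        \<longlonglongrightarrow> rGamma (s - 1 + (\<nu> + 1) + 1) - 0 - 0"
      unfolding sums_def_le by (intro tendsto_diff r1 r2)
    ultimately show ?case
      unfolding sums_def_le by (simp add: add_ac)
  qed
qed

section \<open>Quadratic expansions of hypergeometric series\<close>

text \<open>
  The series of \<open>(1 + c v)^a\<close> and, below, of \<open>(1 + c v\<^sup>2)^a\<close>.
\<close>

definition binomial_lin :: "complex \<Rightarrow> complex \<Rightarrow> complex fps" where
  "binomial_lin a c = fps_binomial a oo (fps_const c * fps_X)"

definition binomial_sq :: "complex \<Rightarrow> complex \<Rightarrow> complex fps" where
  "binomial_sq a c = fps_binomial a oo (fps_const c * fps_X ^ 2)"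

lemma binomial_lin_nth [simp]: "fps_nth (binomial_lin a c) n = c ^ n * (a gchoose n)"
  by (simp add: binomial_lin_def fps_compose_linear)

lemma binomial_sq_nth:
  "fps_nth (binomial_sq a c) n = (if even n then c ^ (n div 2) * (a gchoose (n div 2)) else 0)"
proof -
  have "fps_nth ((fps_const c * fps_X ^ 2) ^ i) n = (if n = 2 * i then c ^ i else 0)" for i
    by (simp add: power_mult_distrib fps_const_power flip: power_mult)
  hence "fps_nth (binomial_sq a c) n = (\<Sum>i=0..n. if n = 2 * i then (a gchoose i) * c ^ i else 0)"
    by (auto simp: binomial_sq_def fps_compose_nth intro!: sum.cong)
  also have "\<dots> = (\<Sum>i=0..n. if i = n div 2 then (if even n then (a gchoose i) * c ^ i else 0) else 0)"
    by (intro sum.cong) auto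
  finally show ?thesis
    by (simp add: mult.commute)
qed

lemma binomial_lin_add: "binomial_lin (a + b) c = binomial_lin a c * binomial_lin b c"
  unfolding binomial_lin_def fps_binomial_add_mult by (rule fps_compose_mult_distrib) simp

lemma binomial_sq_add: "binomial_sq (a + b) c = binomial_sq a c * binomial_sq b c"
  unfolding binomial_sq_def fps_binomial_add_mult by (rule fps_compose_mult_distrib) simp

lemma binomial_lin_0 [simp]: "binomial_lin 0 c = 1"
  by (simp add: binomial_lin_def)

lemma binomial_sq_0 [simp]: "binomial_sq 0 c = 1"
  by (simp add: binomial_sq_def)

text \<open>
  The binomial series converges at \<open>r = 2 / (1 + |c|)\<close>, a point beyond 1 with \<open>|c| r < 1\<close>. For
  the series in \<open>v\<^sup>2\<close> the square root of this point serves.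
\<close>

lemma fps_conv_radius_binomial_lin:
  assumes "norm c < 1"
  shows "fps_conv_radius (binomial_lin a c) > 1"
proof -
  define r where "r = 2 / (1 + norm c)"
  have r: "r > 1" "norm c * r < 1"
    using assms unfolding r_def by (auto simp: field_simps add_pos_nonneg)
  have "summable (\<lambda>n. (a gchoose n) * (c * of_real r) ^ n)"
    using gen_binomial_complex[of "c * of_real r" a] r by (simp add: norm_mult sums_iff)
  hence "ereal (norm (complex_of_real r)) \<le> fps_conv_radius (binomial_lin a c)"
    unfolding fps_conv_radius_def
    by (intro conv_radius_geI) (simp add: power_mult_distrib mult_ac)
  moreover have "1 < ereal (norm (complex_of_real r))"
    using r by simp
  ultimately show ?thesis
    by (rule less_le_trans[rotated])
qed

lemma sums_even_support:
  fixes f :: "nat \<Rightarrow> complex"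
  assumes "\<And>n. odd n \<Longrightarrow> f n = 0" "(\<lambda>m. f (2 * m)) sums S"
  shows "f sums S"
proof -
  have "(\<lambda>m. f (2 * m)) sums S \<longleftrightarrow> f sums S"
    by (rule sums_mono_reindex) (auto simp: strict_mono_def intro: assms(1))
  with assms(2) show ?thesis by simp
qed

lemma fps_conv_radius_binomial_sq:
  assumes "norm c < 1"
  shows "fps_conv_radius (binomial_sq a c) > 1"
proof -
  define r where "r = sqrt (2 / (1 + norm c))"
  have r2: "r\<^sup>2 = 2 / (1 + norm c)"
    unfolding r_def by simp
  have "2 / (1 + norm c) > 1"
    using assms by (auto simp: field_simps add_pos_nonneg)
  hence r1: "r > 1"
    unfolding r_def by simp
  have r: "norm c * r\<^sup>2 < 1"
    using assms unfolding r2 by (auto simp: field_simps add_pos_nonneg)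
  have "(\<lambda>n. (a gchoose n) * (c * of_real (r\<^sup>2)) ^ n) sums (1 + c * of_real (r\<^sup>2)) powr a"
    by (rule gen_binomial_complex) (use r in \<open>simp add: norm_mult norm_power\<close>)
  hence "(\<lambda>m. fps_nth (binomial_sq a c) (2 * m) * of_real r ^ (2 * m)) sums (1 + c * of_real (r\<^sup>2)) powr a"
    by (simp add: binomial_sq_nth power_mult_distrib mult_ac flip: power_mult)
  hence "summable (\<lambda>n. fps_nth (binomial_sq a c) n * of_real r ^ n)"
    using sums_even_support[of "\<lambda>n. fps_nth (binomial_sq a c) n * of_real r ^ n"]
    by (auto simp: binomial_sq_nth sums_iff)
  hence "ereal (norm (complex_of_real r)) \<le> fps_conv_radius (binomial_sq a c)"
    unfolding fps_conv_radius_def by (rule conv_radius_geI)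
  moreover have "1 < ereal (norm (complex_of_real r))"
    using r1 by simp
  ultimately show ?thesis
    by (rule less_le_trans[rotated])
qed

lemma fps_conv_radius_mult_gt:
  fixes A B :: "complex fps"
  assumes "fps_conv_radius A > 1" "fps_conv_radius B > 1"
  shows "fps_conv_radius (A * B) > 1"
  using assms fps_conv_radius_mult[of A B] by (auto simp: min_def intro: less_le_trans split: if_splits)

text \<open>
  In terms of the functional \<open>B\<close> of the introduction, this is \<open>B ((1 - z v)^\<nu>)\<close> by Euler's integral, and
  termwise by \<open>legendre_series_sums\<close>.
\<close>

definition legendre_series :: "complex \<Rightarrow> complex \<Rightarrow> complex \<Rightarrow> complex" where
  "legendre_series \<nu> s z = eval_fps (hyp2F1_reg_fps (- \<nu>) s (s + \<nu> + 1)) z"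

lemma
  assumes "norm z < 1"
  shows legendre_series_sums:
      "(\<lambda>k. fps_nth (binomial_lin \<nu> (- z)) k * beta_moment \<nu> s k) sums legendre_series \<nu> s z"
    and legendre_series_summable:
      "summable (\<lambda>k. fps_nth (hyp2F1_reg_fps (- \<nu>) s (s + \<nu> + 1)) k * z ^ k)"
proof -
  obtain D where D: "\<And>k. norm (beta_moment \<nu> s k) \<le> D * real (Suc k) powr (- Re \<nu> - 1)"
    using beta_moment_powr_bound by blast
  have sm: "summable (\<lambda>k. fps_nth (binomial_lin \<nu> (- z)) k * beta_moment \<nu> s k)"
  proof (rule summable_comparison_test')
    show "summable (\<lambda>k. D * (norm (fps_nth (binomial_lin \<nu> (- z)) k) * real (Suc k) powr (- Re \<nu> - 1)))"
      by (intro summable_mult summable_powr_weight fps_conv_radius_binomial_lin) (use assms in simp)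
    show "norm (fps_nth (binomial_lin \<nu> (- z)) k * beta_moment \<nu> s k) \<le>
        D * (norm (fps_nth (binomial_lin \<nu> (- z)) k) * real (Suc k) powr (- Re \<nu> - 1))" for k
      using mult_left_mono[OF D[of k], of "norm (fps_nth (binomial_lin \<nu> (- z)) k)"]
      by (simp add: norm_mult mult_ac)
  qed
  have eq: "fps_nth (binomial_lin \<nu> (- z)) k * beta_moment \<nu> s k =
      fps_nth (hyp2F1_reg_fps (- \<nu>) s (s + \<nu> + 1)) k * z ^ k" for k
  proof -
    have "(- z) ^ k * (\<nu> gchoose k) = ((- z) ^ k * (- 1) ^ k) * (pochhammer (- \<nu>) k / fact k)"
      unfolding gbinomial_pochhammer by simp
    also have "(- z) ^ k * (- 1) ^ k = z ^ k"
      unfolding power_mult_distrib [symmetric] by simp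
    finally show ?thesis
      by (simp add: hyp2F1_reg_fps_def beta_moment_def mult_ac)
  qed
  show "(\<lambda>k. fps_nth (binomial_lin \<nu> (- z)) k * beta_moment \<nu> s k) sums legendre_series \<nu> s z"
    using sm unfolding eq legendre_series_def eval_fps_def by (rule summable_sums)
  show "summable (\<lambda>k. fps_nth (hyp2F1_reg_fps (- \<nu>) s (s + \<nu> + 1)) k * z ^ k)"
    using sm unfolding eq .
qed

lemma shifted_beta_moment_sums:
  assumes "norm z < 1"
  shows "(\<lambda>k. fps_nth (binomial_lin \<nu> (- z)) k * beta_moment \<nu> s (n + k)) sums
           (pochhammer s n * legendre_series \<nu> (s + of_nat n) z)"
  using sums_mult[OF legendre_series_sums[OF assms, of \<nu> "s + of_nat n"], of "pochhammer s n"]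
  by (simp add: beta_moment_add mult_ac)

text \<open>
  The value of the functional \<open>D\<close> at \<open>v^n (1 + z v\<^sup>2)^\<nu>\<close>. Only even powers contribute beyond \<open>v^n\<close>, so
  it is again a series of the first kind, at half the parameter.
\<close>

lemma shifted_sq_moment_sums:
  assumes "norm z < 1"
  shows "(\<lambda>k. fps_nth (binomial_sq \<nu> z) k * sq_moment \<nu> s (n + k)) sums
           (pochhammer s n * half_Gamma_quot (s + of_nat n) * legendre_series \<nu> ((s + of_nat n) / 2) (- z))"
proof (rule sums_even_support)
  let ?s = "s + of_nat n"
  have "(\<lambda>m. pochhammer s n * half_Gamma_quot ?s * (fps_nth (binomial_lin \<nu> (- (- z))) m * beta_moment \<nu> (?s / 2) m)) sums
      (pochhammer s n * half_Gamma_quot ?s * legendre_series \<nu> (?s / 2) (- z))"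
    by (intro sums_mult legendre_series_sums) (use assms in simp)
  thus "(\<lambda>m. fps_nth (binomial_sq \<nu> z) (2 * m) * sq_moment \<nu> s (n + 2 * m)) sums
      (pochhammer s n * half_Gamma_quot ?s * legendre_series \<nu> (?s / 2) (- z))"
    unfolding sq_moment_add sq_moment_even by (simp add: binomial_sq_nth mult_ac)
qed (auto simp: binomial_sq_nth)

text \<open>
  The bound is allowed to grow polynomially in the shift, since it is only summed against
  coefficients of a series of radius greater than 1.
\<close>

lemma absolute_moment_bound:
  fixes h l :: "nat \<Rightarrow> complex"
  assumes h: "\<And>n. norm (h n) \<le> C * real (Suc n) powr p"
    and l: "\<And>n. norm (l n) \<le> D * real (Suc n) powr q" and pq: "p + q < -1"
  shows "summable (\<lambda>n. h n * l (n + k))"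
    and "\<exists>E. \<forall>k N. norm (\<Sum>n<N. h n * l (n + k)) \<le> E * real (Suc k) powr \<bar>q\<bar>"
proof -
  have C0: "C \<ge> 0" using order.trans[OF norm_ge_zero h[of 0]] by simp
  have D0: "D \<ge> 0" using order.trans[OF norm_ge_zero l[of 0]] by simp
  let ?M = "\<lambda>k n. C * D * real (Suc k) powr \<bar>q\<bar> * real (Suc n) powr (p + q)"
  have M: "norm (h n * l (n + k)) \<le> ?M k n" for n k
  proof -
    have "norm (l (n + k)) \<le> D * (real (Suc n) powr q * real (Suc k) powr \<bar>q\<bar>)"
      using l[of "n + k"] powr_shift_le(1)[of n k q] D0 by (auto intro: order.trans mult_left_mono)
    hence "norm (h n * l (n + k)) \<le> (C * real (Suc n) powr p) * (D * (real (Suc n) powr q * real (Suc k) powr \<bar>q\<bar>))"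
      unfolding norm_mult using C0 by (intro mult_mono h) auto
    also have "\<dots> = ?M k n"
      by (simp only: powr_add mult_ac)
    finally show ?thesis .
  qed
  have sm: "summable (\<lambda>n. real (Suc n) powr (p + q))"
    by (rule summable_Suc_powr[OF pq])
  show "summable (\<lambda>n. h n * l (n + k))"
    by (rule summable_comparison_test'[OF summable_mult[OF sm] M])
  have "norm (\<Sum>n<N. h n * l (n + k)) \<le> (C * D * suminf (\<lambda>n. real (Suc n) powr (p + q))) * real (Suc k) powr \<bar>q\<bar>" for k N
  proof -
    have "norm (\<Sum>n<N. h n * l (n + k)) \<le> (\<Sum>n<N. ?M k n)"
      by (rule order.trans[OF norm_sum sum_mono[OF M]])
    also have "\<dots> \<le> (C * D * real (Suc k) powr \<bar>q\<bar>) * suminf (\<lambda>n. real (Suc n) powr (p + q))"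
      unfolding sum_distrib_left [symmetric] using C0 D0
      by (intro mult_left_mono sum_le_suminf sm) auto
    finally show ?thesis
      by (simp add: mult_ac)
  qed
  thus "\<exists>E. \<forall>k N. norm (\<Sum>n<N. h n * l (n + k)) \<le> E * real (Suc k) powr \<bar>q\<bar>"
    by blast
qed

lemma fps_mult_nth_atMost: "fps_nth (A * B) n = (\<Sum>k\<le>n. fps_nth A k * fps_nth B (n - k))"
  by (simp add: fps_mult_nth atLeast0AtMost)

text \<open>
  \<open>B ((1 - q v)^\<nu>) = D ((1 - q v)^\<nu> (1 + v)^(-\<nu>)) = D (G (1 + q v\<^sup>2)^\<nu>)\<close>. The first step is the inverse
  Kummer formula, the second an identity between formal power series. Both require a rearrangement,
  which the decay of \<open>G\<close> times the moments like \<open>n^(-2)\<close> justifies.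
\<close>

theorem legendre_series_quadratic_expansion:
  fixes q s \<nu> :: complex
  assumes q: "norm q < 1"
  defines "G \<equiv> binomial_lin \<nu> (- q) * binomial_lin (- \<nu>) 1 * binomial_sq (- \<nu>) q"
  shows "(\<lambda>n. fps_nth G n * (pochhammer s n * half_Gamma_quot (s + of_nat n) *
            legendre_series \<nu> ((s + of_nat n) / 2) (- q))) sums legendre_series \<nu> s q"
proof -
  let ?b = "binomial_lin (- \<nu>) 1" and ?a = "binomial_lin \<nu> (- q)" and ?c = "binomial_sq \<nu> q"
  let ?l = "sq_moment \<nu> s"
  have ra: "fps_conv_radius ?a > 1" and rc: "fps_conv_radius ?c > 1"
    using q by (auto intro: fps_conv_radius_binomial_lin fps_conv_radius_binomial_sq)
  obtain B where B: "\<And>n. norm (fps_nth ?b n) \<le> B * real (Suc n) powr (Re \<nu> - 1)"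
    using gbinomial_powr_bound[of "- \<nu>"] by auto
  have "fps_conv_radius (?a * binomial_sq (- \<nu>) q) > 1"
    by (intro fps_conv_radius_mult_gt ra fps_conv_radius_binomial_sq q)
  from fps_mult_powr_bound[OF this B] obtain H where H: "\<And>n. norm (fps_nth G n) \<le> H * real (Suc n) powr (Re \<nu> - 1)"
    by (auto simp: G_def mult_ac)
  obtain D where D: "\<And>n. norm (?l n) \<le> D * real (Suc n) powr (- Re \<nu> - 1)"
    using sq_moment_powr_bound by blast
  have pq: "Re \<nu> - 1 + (- Re \<nu> - 1) < -1" by simp
  obtain EG where EG: "\<And>k N. norm (\<Sum>n<N. fps_nth G n * ?l (n + k)) \<le> EG * real (Suc k) powr \<bar>- Re \<nu> - 1\<bar>"
    using absolute_moment_bound(2)[OF H D pq] by blast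
  obtain Eb where Eb: "\<And>k N. norm (\<Sum>n<N. fps_nth ?b n * ?l (n + k)) \<le> Eb * real (Suc k) powr \<bar>- Re \<nu> - 1\<bar>"
    using absolute_moment_bound(2)[OF B D pq] by blast
  have weight: "summable (\<lambda>k. norm (fps_nth A k) * (E * real (Suc k) powr \<bar>- Re \<nu> - 1\<bar>))"
    if "fps_conv_radius A > 1" for A :: "complex fps" and E :: real
    using summable_mult[OF summable_powr_weight[OF that], of E] by (simp add: mult_ac)
  have bS: "(\<lambda>n. fps_nth ?b n * ?l (n + k)) sums beta_moment \<nu> s k" for k
    using sums_mult[OF inverse_kummer[of \<nu> "s + of_nat k"], of "pochhammer s k"]
    by (simp add: sq_moment_add[of \<nu> s k, unfolded add.commute[of k]] beta_moment_def add_ac mult_ac)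
  note GS = summable_sums[OF absolute_moment_bound(1)[OF H D pq]]
  have ab_cG: "?a * ?b = ?c * G"
    using binomial_sq_add[of \<nu> "- \<nu>" q] by (simp add: G_def mult_ac)
  have "(\<lambda>n. fps_nth (?c * G) n * ?l n) sums (\<Sum>k. fps_nth ?a k * beta_moment \<nu> s k)"
    using moment_rearrangement(2)[OF bS Eb weight[OF ra]] unfolding ab_cG [symmetric] fps_mult_nth_atMost .
  also have "(\<Sum>k. fps_nth ?a k * beta_moment \<nu> s k) = legendre_series \<nu> s q"
    using legendre_series_sums[OF q] by (simp only: sums_iff)
  finally have val: "(\<lambda>n. fps_nth (?c * G) n * ?l n) sums legendre_series \<nu> s q" .
  have "(\<lambda>n. fps_nth (?c * G) n * ?l n) sums (\<Sum>k. fps_nth ?c k * (\<Sum>n. fps_nth G n * ?l (n + k)))"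
    unfolding fps_mult_nth_atMost by (rule moment_rearrangement(2)[OF GS EG weight[OF rc]])
  from sums_unique2[OF this val] show ?thesis
    using moment_rearrangement(3)[OF GS EG weight[OF rc] shifted_sq_moment_sums[OF q]] by (simp only:)
qed

text \<open>
  The coefficients of \<open>(1 + v)^(\<nu>+1)\<close> are sums of two consecutive coefficients of \<open>(1 + v)^\<nu>\<close>, and
  they are absolutely summable. So twice a partial sum is a bounded quantity up to one coefficient.
\<close>

lemma binomial_partial_sums_bounded:
  assumes "Re \<nu> > -1"
  shows "\<exists>R. \<forall>N. norm (\<Sum>n<N. \<nu> gchoose n) \<le> R"
proof -
  obtain C where C: "\<And>n. norm (\<nu> gchoose n) \<le> C * real (Suc n) powr (- Re \<nu> - 1)"
    using gbinomial_powr_bound by blast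
  have C0: "C \<ge> 0" using order.trans[OF norm_ge_zero C[of 0]] by simp
  have C1: "norm (\<nu> gchoose n) \<le> C" for n
  proof -
    have "real (Suc n) powr (- Re \<nu> - 1) \<le> real (Suc n) powr 0"
      using assms by (intro powr_mono) auto
    from mult_left_mono[OF this C0] C[of n] show ?thesis by simp
  qed
  have sm: "summable (\<lambda>n. norm ((\<nu> + 1) gchoose n))"
    using assms by (intro binomial_sum_at_1(2)) auto
  let ?A = "suminf (\<lambda>n. norm ((\<nu> + 1) gchoose n))"
  have "norm (\<Sum>n<N. \<nu> gchoose n) \<le> (?A + C) / 2" for N
  proof (cases N)
    case 0
    have "0 \<le> ?A" by (intro suminf_nonneg sm) auto
    thus ?thesis using 0 C0 by simp
  next
    case (Suc M)
    have "2 * (\<Sum>n\<le>M. \<nu> gchoose n) = (\<Sum>n\<le>M. (\<nu> + 1) gchoose n) + (\<nu> gchoose M)"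
      by (induction M) (use gbinomial_Suc_Suc[of \<nu>] in \<open>auto simp: algebra_simps\<close>)
    hence "2 * norm (\<Sum>n\<le>M. \<nu> gchoose n) = norm ((\<Sum>n\<le>M. (\<nu> + 1) gchoose n) + (\<nu> gchoose M))"
      using norm_mult[of 2 "\<Sum>n\<le>M. \<nu> gchoose n"] by simp
    also have "\<dots> \<le> (\<Sum>n\<le>M. norm ((\<nu> + 1) gchoose n)) + C"
      by (intro norm_triangle_mono norm_sum C1)
    also have "\<dots> \<le> ?A + C"
      by (intro add_right_mono sum_le_suminf sm) auto
    finally show ?thesis
      using Suc by (simp add: lessThan_Suc_atMost)
  qed
  thus ?thesis by blast
qed

text \<open>
  For \<open>Re \<nu> > -1\<close> the moments tend to 0 with finite total variation, because their differences are
  moments for the exponent \<open>\<nu> + 1\<close>; this makes Dirichlet's test applicable. If \<open>-s\<close> is a natural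
  number, only finitely many moments are nonzero.
\<close>

lemma conditional_moment_bound:
  fixes A :: "complex fps" and \<nu> s :: complex
  assumes A: "fps_conv_radius A > 1" and \<nu>s: "Re \<nu> > -1 \<or> (\<exists>m. s = - of_nat m)"
  defines "h \<equiv> fps_nth (A * binomial_lin \<nu> 1)"
  shows "\<And>k. summable (\<lambda>n. h n * beta_moment \<nu> s (n + k))"
    and "\<exists>R. \<forall>k N. norm (\<Sum>n<N. h n * beta_moment \<nu> s (n + k)) \<le> R"
proof -
  let ?l = "beta_moment \<nu> s"
  have "(\<forall>k. summable (\<lambda>n. h n * ?l (n + k))) \<and> (\<exists>R. \<forall>k N. norm (\<Sum>n<N. h n * ?l (n + k)) \<le> R)"
    using \<nu>s
  proof
    assume \<nu>: "Re \<nu> > -1"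
    obtain R where "\<And>N. norm (\<Sum>n<N. fps_nth (binomial_lin \<nu> 1) n) \<le> R"
      using binomial_partial_sums_bounded[OF \<nu>] by auto
    from fps_mult_partial_sums_bounded[OF A this] obtain H where H: "\<And>N. norm (\<Sum>n<N. h n) \<le> H"
      unfolding h_def by blast
    obtain D where D: "\<And>n. norm (beta_moment (\<nu> + 1) s n) \<le> D * real (Suc n) powr (- Re (\<nu> + 1) - 1)"
      using beta_moment_powr_bound by blast
    have V: "summable (\<lambda>n. norm (?l n - ?l (Suc n)))"
    proof (rule summable_comparison_test')
      show "summable (\<lambda>n. norm (\<nu> + 1) * D * real (Suc n) powr (- Re (\<nu> + 1) - 1))"
        using \<nu> by (intro summable_mult summable_Suc_powr) auto
      show "norm (norm (?l n - ?l (Suc n))) \<le> norm (\<nu> + 1) * D * real (Suc n) powr (- Re (\<nu> + 1) - 1)" for n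
        using mult_left_mono[OF D[of n], of "norm (\<nu> + 1)"]
        by (simp add: beta_moment_diff norm_mult mult.assoc)
    qed
    obtain E where E: "\<And>n. norm (?l n) \<le> E * real (Suc n) powr (- Re \<nu> - 1)"
      using beta_moment_powr_bound by blast
    have "p < 0 \<Longrightarrow> (\<lambda>n. E * real (Suc n) powr p) \<longlonglongrightarrow> 0" for p :: real
      by real_asymp
    from this[of "- Re \<nu> - 1"] have l0: "?l \<longlonglongrightarrow> 0"
      by (rule Lim_null_comparison[OF always_eventually, rotated]) (use E \<nu> in auto)
    show ?thesis
      using dirichlet_shifted[OF H V l0] by blast
  next
    assume "\<exists>m. s = - of_nat m"
    then obtain m where m: "s = - of_nat m" by blast
    have z: "?l n = 0" if "n > m" for n
      using that by (simp add: m beta_moment_terminates)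
    have le: "n \<le> m" if "?l (n + k) \<noteq> 0" for n k
      using z[of "n + k"] that by (cases "n \<le> m") auto
    define L where "L = (\<Sum>n\<le>m. norm (?l n))"
    have L: "norm (?l n) \<le> L" for n
    proof (cases "n \<le> m")
      case True
      thus ?thesis unfolding L_def by (intro member_le_sum) auto
    qed (auto simp: z L_def intro: sum_nonneg)
    have "summable (\<lambda>n. h n * ?l (n + k))" for k
      by (rule summable_finite[of "{..m}"]) (auto simp: z)
    moreover have "norm (\<Sum>n<N. h n * ?l (n + k)) \<le> (\<Sum>n\<le>m. norm (h n) * L)" for N k
    proof -
      have "norm (\<Sum>n<N. h n * ?l (n + k)) = norm (\<Sum>n\<in>{..<N} \<inter> {..m}. h n * ?l (n + k))"
        by (intro arg_cong[where f = norm] sum.mono_neutral_right) (auto dest: le)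
      also have "\<dots> \<le> (\<Sum>n\<in>{..<N} \<inter> {..m}. norm (h n) * L)"
        by (intro order.trans[OF norm_sum] sum_mono) (auto simp: norm_mult intro!: mult_left_mono L)
      also have "\<dots> \<le> (\<Sum>n\<le>m. norm (h n) * L)"
        using order.trans[OF norm_ge_zero L] by (intro sum_mono2) auto
      finally show ?thesis .
    qed
    ultimately show ?thesis by blast
  qed
  thus "\<And>k. summable (\<lambda>n. h n * ?l (n + k))" "\<exists>R. \<forall>k N. norm (\<Sum>n<N. h n * ?l (n + k)) \<le> R"
    by auto
qed

text \<open>
  \<open>D ((1 + q v\<^sup>2)^\<nu>) = B ((1 + q v\<^sup>2)^\<nu> (1 + v)^\<nu>) = B (H (1 - q v)^\<nu>)\<close>, with Kummer's theorem in the first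
  step. For \<open>-1 < Re \<nu> \<le> -1/2\<close> convergence is in general only conditional, and the rearrangements rest on
  bounded partial sums.
\<close>

theorem legendre_series_quadratic_inverse:
  fixes q s \<nu> :: complex
  assumes q: "norm q < 1" and \<nu>s: "Re \<nu> > -1 \<or> (\<exists>m. s = - of_nat m)"
  defines "H \<equiv> binomial_lin (- \<nu>) (- q) * binomial_lin \<nu> 1 * binomial_sq \<nu> q"
  shows "(\<lambda>n. fps_nth H n * (pochhammer s n * legendre_series \<nu> (s + of_nat n) q)) sums
           (half_Gamma_quot s * legendre_series \<nu> (s / 2) (- q))"
proof -
  let ?b = "binomial_lin \<nu> 1" and ?a = "binomial_lin \<nu> (- q)" and ?c = "binomial_sq \<nu> q"
  let ?l = "beta_moment \<nu> s"
  have ra: "fps_conv_radius ?a > 1" and rc: "fps_conv_radius ?c > 1"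
    using q by (auto intro: fps_conv_radius_binomial_lin fps_conv_radius_binomial_sq)
  have "fps_conv_radius (binomial_lin (- \<nu>) (- q) * ?c) > 1"
    using q by (intro fps_conv_radius_mult_gt rc fps_conv_radius_binomial_lin) auto
  note HM = conditional_moment_bound[OF this \<nu>s]
  have "binomial_lin (- \<nu>) (- q) * ?c * ?b = H"
    by (simp add: H_def mult_ac)
  note HM = HM[unfolded this]
  note bM = conditional_moment_bound[of 1, OF _ \<nu>s, simplified]
  obtain RH where RH: "\<And>k N. norm (\<Sum>n<N. fps_nth H n * ?l (n + k)) \<le> RH"
    using HM(2) by blast
  obtain Rb where Rb: "\<And>k N. norm (\<Sum>n<N. fps_nth ?b n * ?l (n + k)) \<le> Rb"
    using bM(2) by auto
  have weight: "summable (\<lambda>k. norm (fps_nth A k) * E)" if "fps_conv_radius A > 1" for A :: "complex fps" and E :: real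
    using summable_mult2[OF summable_powr_weight[OF that, of 0], of E] by simp
  have bS: "(\<lambda>n. fps_nth ?b n * ?l (n + k)) sums sq_moment \<nu> s k" for k
  proof -
    \<comment> \<open>If \<open>s = -m\<close>, shifting by \<open>k \<le> m\<close> stays within the terminating case, and for \<open>k > m\<close> both sides vanish.\<close>
    have "Re \<nu> > -1 \<or> (\<exists>m. s + of_nat k = - of_nat m) \<or> pochhammer s k = 0"
    proof (cases "Re \<nu> > -1")
      case False
      then obtain m where m: "s = - of_nat m" using \<nu>s by blast
      show ?thesis
      proof (cases "k \<le> m")
        case True
        hence "s + of_nat k = - of_nat (m - k)" by (simp add: m of_nat_diff)
        thus ?thesis by blast
      qed (simp add: m pochhammer_of_nat_eq_0_lemma)
    qed simp
    hence "(\<lambda>n. pochhammer s k * ((\<nu> gchoose n) * beta_moment \<nu> (s + of_nat k) n)) sums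
        (pochhammer s k * sq_moment \<nu> (s + of_nat k) 0)"
      using kummer[of \<nu> "s + of_nat k"] by (auto intro: sums_mult)
    thus ?thesis
      using sq_moment_add[of \<nu> s k 0]
      by (simp add: beta_moment_add[of \<nu> s k, unfolded add.commute[of k]] mult_ac)
  qed
  note HS = summable_sums[OF HM(1)]
  have cb_aH: "?c * ?b = ?a * H"
    using binomial_lin_add[of \<nu> "- \<nu>" "- q"] by (simp add: H_def mult_ac)
  have "(\<lambda>n. fps_nth (?a * H) n * ?l n) sums (\<Sum>k. fps_nth ?c k * sq_moment \<nu> s k)"
    using moment_rearrangement(2)[OF bS Rb weight[OF rc]] unfolding cb_aH [symmetric] fps_mult_nth_atMost .
  also have "(\<Sum>k. fps_nth ?c k * sq_moment \<nu> s k) = half_Gamma_quot s * legendre_series \<nu> (s / 2) (- q)"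
    using shifted_sq_moment_sums[OF q, of \<nu> s 0] by (simp add: sums_iff)
  finally have val: "(\<lambda>n. fps_nth (?a * H) n * ?l n) sums (half_Gamma_quot s * legendre_series \<nu> (s / 2) (- q))" .
  have "(\<lambda>n. fps_nth (?a * H) n * ?l n) sums (\<Sum>k. fps_nth ?a k * (\<Sum>n. fps_nth H n * ?l (n + k)))"
    unfolding fps_mult_nth_atMost by (rule moment_rearrangement(2)[OF HS RH weight[OF ra]])
  from sums_unique2[OF this val] show ?thesis
    using moment_rearrangement(3)[OF HS RH weight[OF ra] shifted_beta_moment_sums[OF q]] by (simp only:)
qed

section \<open>Pfaff's transformation and Legendre functions\<close>

lemma binomial_sum_Suc:
  fixes f :: "nat \<Rightarrow> complex"
  shows "(\<Sum>k\<le>Suc n. of_nat (Suc n choose k) * f k) =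
    (\<Sum>k\<le>n. of_nat (n choose k) * f k) + (\<Sum>k\<le>n. of_nat (n choose k) * f (Suc k))"
proof -
  have "(\<Sum>k\<le>n. of_nat (n choose k) * f k) = (\<Sum>k\<le>Suc n. of_nat (n choose k) * f k)"
    by (simp add: binomial_eq_0)
  also have "\<dots> = f 0 + (\<Sum>k\<le>n. of_nat (n choose Suc k) * f (Suc k))"
    by (subst sum.atMost_Suc_shift) simp
  finally show ?thesis
    by (subst sum.atMost_Suc_shift) (simp add: sum.distrib algebra_simps)
qed

text \<open>
  The Chu--Vandermonde identity, divided by \<open>\<Gamma>(c)\<close> and therefore valid for all \<open>c\<close>. It follows by
  induction from Pascal's rule.
\<close>

lemma vandermonde_rGamma:
  fixes c d :: complex
  shows "(\<Sum>k\<le>n. of_nat (n choose k) * ((-1) ^ k * pochhammer d k * rGamma (c + of_nat k))) =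
    pochhammer (c - d) n * rGamma (c + of_nat n)"
proof (induction n arbitrary: c d)
  case (Suc n)
  let ?f = "\<lambda>c d k. (-1) ^ k * pochhammer d k * rGamma (c + of_nat k)"
  have "?f c d (Suc k) = - d * ?f (c + 1) (d + 1) k" for k
    by (simp add: pochhammer_rec add_ac)
  hence "(\<Sum>k\<le>n. of_nat (n choose k) * ?f c d (Suc k)) = - d * (\<Sum>k\<le>n. of_nat (n choose k) * ?f (c + 1) (d + 1) k)"
    by (simp only: sum_distrib_left mult.left_commute)
  hence "(\<Sum>k\<le>Suc n. of_nat (Suc n choose k) * ?f c d k) =
      pochhammer (c - d) n * (rGamma (c + of_nat n) - d * rGamma (c + 1 + of_nat n))"
    unfolding binomial_sum_Suc Suc.IH by (simp add: algebra_simps)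
  also have "rGamma (c + of_nat n) = (c + of_nat n) * rGamma (c + 1 + of_nat n)"
    by (rule rGamma_step) simp
  also have "(c + of_nat n) * rGamma (c + 1 + of_nat n) - d * rGamma (c + 1 + of_nat n) =
      (c - d + of_nat n) * rGamma (c + of_nat (Suc n))"
    by (simp add: algebra_simps)
  finally show ?case
    by (simp only: pochhammer_Suc mult.assoc)
qed simp

text \<open>
  The expansion of \<open>z / (z - 1)\<close> at 0.
\<close>

definition pfaff_subst_fps :: "complex fps" where
  "pfaff_subst_fps = fps_const (- 1) * fps_X * binomial_lin (- 1) (- 1)"

lemma binomial_lin_power: "binomial_lin a c ^ n = binomial_lin (of_nat n * a) c"
  by (induction n) (simp_all add: binomial_lin_add [symmetric] algebra_simps)

text \<open>
  Since \<open>Y^i\<close> has no terms below degree \<open>i\<close>, finitely many terms of \<open>F\<close> determine the coefficient.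
\<close>

lemma fps_mult_compose_nth:
  fixes P F Y :: "complex fps"
  assumes "fps_nth Y 0 = 0"
  shows "fps_nth (P * (F oo Y)) n = (\<Sum>i\<le>n. fps_nth F i * fps_nth (P * Y ^ i) n)"
proof -
  have "fps_nth (F oo Y) m = (\<Sum>i\<le>n. fps_nth F i * fps_nth (Y ^ i) m)" if "m \<le> n" for m
    unfolding fps_compose_nth
    by (rule sum.mono_neutral_left) (use that startsby_zero_power_prefix[OF assms] in auto)
  hence "fps_nth (P * (F oo Y)) n = (\<Sum>j=0..n. \<Sum>i\<le>n. fps_nth F i * (fps_nth P j * fps_nth (Y ^ i) (n - j)))"
    by (simp add: fps_mult_nth sum_distrib_left mult_ac)
  also have "\<dots> = (\<Sum>i\<le>n. fps_nth F i * fps_nth (P * Y ^ i) n)"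
    by (subst sum.swap) (simp add: fps_mult_nth sum_distrib_left)
  finally show ?thesis .
qed

text \<open>
  Pfaff's transformation \<open>F(a,b;c;z) = (1 - z)^(-a) F(a,c-b;c;z/(z-1))\<close> for formal power series. The
  coefficient of \<open>z^n\<close> in \<open>(1 - z)^(-a) (z/(z-1))^i\<close> is elementary, and the sum over \<open>i\<close> is of
  Chu--Vandermonde type.
\<close>

lemma pfaff_fps:
  "binomial_lin (- a) (- 1) * (hyp2F1_reg_fps a (c - b) c oo pfaff_subst_fps) = hyp2F1_reg_fps a b c"
proof (rule fps_ext)
  fix n
  have P: "fps_nth (binomial_lin (- a) (- 1) * pfaff_subst_fps ^ i) n =
      (-1) ^ i * (pochhammer (a + of_nat i) (n - i) / fact (n - i))" if "i \<le> n" for i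
  proof -
    have "binomial_lin (- (a + of_nat i)) (- 1) = binomial_lin (- a) (- 1) * binomial_lin (- 1) (- 1) ^ i"
      by (simp add: binomial_lin_power flip: binomial_lin_add)
    hence "binomial_lin (- a) (- 1) * pfaff_subst_fps ^ i =
        fps_const ((-1) ^ i) * (fps_X ^ i * binomial_lin (- (a + of_nat i)) (- 1))"
      by (simp only: pfaff_subst_fps_def power_mult_distrib fps_const_power mult_ac)
    hence "fps_nth (binomial_lin (- a) (- 1) * pfaff_subst_fps ^ i) n =
        (-1) ^ i * ((- 1) ^ (n - i) * (- (a + of_nat i) gchoose (n - i)))"
      using that by (simp add: fps_X_power_mult_nth)
    also have "(- 1) ^ (n - i) * (- (a + of_nat i) gchoose (n - i)) = pochhammer (a + of_nat i) (n - i) / fact (n - i)"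
      by (simp add: gbinomial_pochhammer add_ac flip: power_mult_distrib)
    finally show ?thesis .
  qed
  have "fps_nth (binomial_lin (- a) (- 1) * (hyp2F1_reg_fps a (c - b) c oo pfaff_subst_fps)) n =
      (\<Sum>i\<le>n. fps_nth (hyp2F1_reg_fps a (c - b) c) i * ((-1) ^ i * (pochhammer (a + of_nat i) (n - i) / fact (n - i))))"
  proof -
    have "fps_nth pfaff_subst_fps 0 = 0"
      by (simp add: pfaff_subst_fps_def)
    thus ?thesis
      unfolding fps_mult_compose_nth[OF \<open>fps_nth pfaff_subst_fps 0 = 0\<close>] by (intro sum.cong refl) (simp add: P)
  qed
  also have "\<dots> = (\<Sum>i\<le>n. pochhammer a n / fact n *
      (of_nat (n choose i) * ((-1) ^ i * pochhammer (c - b) i * rGamma (c + of_nat i))))"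
  proof (intro sum.cong refl)
    fix i assume i: "i \<in> {..n}"
    have "pochhammer a n = pochhammer a i * pochhammer (a + of_nat i) (n - i)"
      using i by (intro pochhammer_product) auto
    moreover have "(of_nat (n choose i) :: complex) = fact n / (fact i * fact (n - i))"
      using i by (intro binomial_fact) auto
    ultimately show "fps_nth (hyp2F1_reg_fps a (c - b) c) i *
        ((-1) ^ i * (pochhammer (a + of_nat i) (n - i) / fact (n - i))) =
      pochhammer a n / fact n * (of_nat (n choose i) * ((-1) ^ i * pochhammer (c - b) i * rGamma (c + of_nat i)))"
      by (simp add: hyp2F1_reg_fps_def)
  qed
  also have "\<dots> = fps_nth (hyp2F1_reg_fps a b c) n"
    unfolding sum_distrib_left [symmetric] vandermonde_rGamma by (simp add: hyp2F1_reg_fps_def)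
  finally show "fps_nth (binomial_lin (- a) (- 1) * (hyp2F1_reg_fps a (c - b) c oo pfaff_subst_fps)) n =
      fps_nth (hyp2F1_reg_fps a b c) n" .
qed

lemma has_fps_expansion_binomial_lin: "(\<lambda>z. (1 + c * z) powr a) has_fps_expansion binomial_lin a c"
proof -
  have "(\<lambda>z. c * z) has_fps_expansion fps_const c * fps_X"
    by (intro fps_expansion_intros)
  from has_fps_expansion_compose[OF has_fps_expansion_binomial_complex[of a] this]
  show ?thesis by (simp add: o_def binomial_lin_def)
qed

lemma has_fps_expansion_binomial_sq: "(\<lambda>z. (1 + c * z\<^sup>2) powr a) has_fps_expansion binomial_sq a c"
proof -
  have "(\<lambda>z. c * z ^ 2) has_fps_expansion fps_const c * fps_X ^ 2"
    by (intro fps_expansion_intros)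
  from has_fps_expansion_compose[OF has_fps_expansion_binomial_complex[of a] this]
  show ?thesis by (simp add: o_def binomial_sq_def)
qed

lemma fps_conv_radius_legendre:
  "fps_conv_radius (hyp2F1_reg_fps (- \<nu>) s (s + \<nu> + 1)) \<ge> 1"
  unfolding fps_conv_radius_def
proof (rule conv_radius_geI_ex)
  fix r :: real assume r: "0 < r" "ereal r < 1"
  have "summable (\<lambda>k. fps_nth (hyp2F1_reg_fps (- \<nu>) s (s + \<nu> + 1)) k * of_real r ^ k)"
    by (rule legendre_series_summable) (use r in simp)
  thus "\<exists>z. norm z = r \<and> summable (\<lambda>k. fps_nth (hyp2F1_reg_fps (- \<nu>) s (s + \<nu> + 1)) k * z ^ k)"
    using r by (intro exI[of _ "of_real r"]) auto
qed

text \<open>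
  The right-hand side is holomorphic on the half-plane \<open>Re z < 1/2\<close>, which \<open>z / (z - 1)\<close> maps into the unit
  disc. The half-plane is convex and contains 0, so \<open>hyp2F1_reg\<close> is determined there by the
  expansion at 0. It contains \<open>(1 - y)/2\<close> for every \<open>y > 0\<close>.
\<close>

lemma hyp2F1_reg_pfaff:
  assumes t: "Re t < 1 / 2"
  shows "hyp2F1_reg (- \<nu>) (\<nu> + 1) (s + \<nu> + 1) t = (1 - t) powr \<nu> * legendre_series \<nu> s (t / (t - 1))"
proof -
  define S where "S = {z :: complex. Re z < 1 / 2}"
  define Y where "Y = (\<lambda>z :: complex. - 1 * z * (1 + (- 1) * z) powr (- 1))"
  define F where "F = hyp2F1_reg_fps (- \<nu>) s (s + \<nu> + 1)"
  define f where "f = (\<lambda>z. (1 + (- 1) * z) powr \<nu> * (eval_fps F \<circ> Y) z)"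
  have Y: "Y z = z / (z - 1)" if "z \<in> S" for z
  proof -
    have "z \<noteq> 1" using that by (auto simp: S_def)
    hence inv: "(1 + (- 1) * z) powr (- 1) = inverse (1 - z)"
      by (simp add: powr_minus)
    show ?thesis
      unfolding Y_def inv using \<open>z \<noteq> 1\<close> by (simp add: field_simps)
  qed
  have Y_bound: "norm (Y z) < 1" if "z \<in> S" for z
  proof -
    have "z \<noteq> 1" using that by (auto simp: S_def)
    have "(norm z)\<^sup>2 < (norm (z - 1))\<^sup>2"
      using that by (simp add: S_def cmod_power2) (simp add: power2_eq_square algebra_simps)
    hence "norm z < norm (z - 1)"
      by (rule power2_less_imp_less) simp
    thus ?thesis
      using \<open>z \<noteq> 1\<close> by (simp add: Y[OF that] norm_divide)
  qed
  have branch: "1 + (- 1) * z \<notin> \<real>\<^sub>\<le>\<^sub>0" if "z \<in> S" for z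
    using that by (auto simp: S_def complex_nonpos_Reals_iff)
  have "S \<subseteq> S" by simp
  have "hyp2F1_reg (- \<nu>) (\<nu> + 1) (s + \<nu> + 1) t = f t"
  proof (rule hyp2F1_reg_eqI[of S])
    show "open S"
      unfolding S_def by (rule open_halfspace_Re_lt)
    show "t \<in> S" using t by (simp add: S_def)
    show "closed_segment 0 z \<subseteq> S" if "z \<in> S" for z
      using that by (intro closed_segment_subset) (auto simp: S_def simp del: less_divide_eq_numeral1 intro: convex_halfspace_Re_lt)
    have "Y holomorphic_on S"
      unfolding Y_def by (intro holomorphic_intros branch)
    moreover have "eval_fps F holomorphic_on ball 0 1"
    proof (rule holomorphic_on_eval_fps)
      show "ball 0 1 \<subseteq> eball 0 (fps_conv_radius F)"
        using fps_conv_radius_legendre[of \<nu> s] unfolding F_def one_ereal_def by (rule ball_eball_mono)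
    qed
    ultimately have "(eval_fps F \<circ> Y) holomorphic_on S"
      by (rule holomorphic_on_compose_gen) (use Y_bound in auto)
    thus "f holomorphic_on S"
      unfolding f_def by (intro holomorphic_intros branch)
    have Y_exp: "Y has_fps_expansion pfaff_subst_fps"
      unfolding Y_def pfaff_subst_fps_def
      by (intro fps_expansion_intros has_fps_expansion_binomial_lin)
    have "0 < fps_conv_radius F"
      unfolding F_def by (rule less_le_trans[OF _ fps_conv_radius_legendre]) simp
    hence F_exp: "eval_fps F has_fps_expansion F"
      by (rule eval_fps_has_fps_expansion)
    have "fps_nth pfaff_subst_fps 0 = 0"
      by (simp add: pfaff_subst_fps_def)
    hence "f has_fps_expansion binomial_lin \<nu> (- 1) * (F oo pfaff_subst_fps)"
      unfolding f_def
      by (rule has_fps_expansion_mult[OF has_fps_expansion_binomial_lin has_fps_expansion_compose[OF F_exp Y_exp]])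
    thus "f has_fps_expansion hyp2F1_reg_fps (- \<nu>) (\<nu> + 1) (s + \<nu> + 1)"
      using pfaff_fps[of "- \<nu>" "s + \<nu> + 1" "\<nu> + 1"] by (simp add: F_def)
  qed
  also have "\<dots> = (1 - t) powr \<nu> * legendre_series \<nu> s (t / (t - 1))"
    using Y[of t] t by (simp add: f_def legendre_series_def F_def S_def)
  finally show ?thesis .
qed

lemma legendreP_conv_series:
  assumes "y > 0" and \<mu>: "\<mu> = s + \<nu>"
  shows "legendreP \<nu> (- \<mu>) y = of_real \<bar>(1 - y) / (1 + y)\<bar> powr (\<mu> / 2) * of_real ((1 + y) / 2) powr \<nu> *
           legendre_series \<nu> s (of_real ((y - 1) / (y + 1)))"
proof -
  let ?t = "complex_of_real ((1 - y) / 2)"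
  have "hyp2F1_reg (- \<nu>) (\<nu> + 1) (s + \<nu> + 1) ?t = (1 - ?t) powr \<nu> * legendre_series \<nu> s (?t / (?t - 1))"
    by (rule hyp2F1_reg_pfaff) (use assms in simp)
  moreover have "1 - ?t = of_real (1 - (1 - y) / 2)" "?t / (?t - 1) = of_real (((1 - y) / 2) / ((1 - y) / 2 - 1))"
    by (simp_all only: of_real_diff of_real_divide of_real_1)
  moreover have "1 - (1 - y) / 2 = (1 + y) / 2" "((1 - y) / 2) / ((1 - y) / 2 - 1) = (y - 1) / (y + 1)"
    using assms by (auto simp: field_simps)
  moreover have "1 - - \<mu> = s + \<nu> + 1"
    by (simp add: \<mu>)
  ultimately show ?thesis
    unfolding legendreP_def by (simp only: mult.assoc minus_minus)
qed

section \<open>Generating functions and the expansion formulas\<close>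

lemma binomial_lin_scale: "binomial_lin a c oo (fps_const w * fps_X) = binomial_lin a (c * w)"
  by (rule fps_ext) (simp add: fps_compose_linear, simp add: power_mult_distrib mult_ac)

lemma binomial_sq_scale: "binomial_sq a c oo (fps_const w * fps_X) = binomial_sq a (c * w\<^sup>2)"
  by (rule fps_ext) (simp add: fps_compose_linear binomial_sq_nth,
      auto simp: power_mult_distrib mult_ac simp flip: power_mult elim!: evenE)

lemma scaled_product_nth:
  "w ^ n * fps_nth (binomial_lin a b * binomial_lin c d * binomial_sq e f) n =
   fps_nth (binomial_lin a (b * w) * binomial_lin c (d * w) * binomial_sq e (f * w\<^sup>2)) n"
proof -
  have "w ^ n * fps_nth (binomial_lin a b * binomial_lin c d * binomial_sq e f) n =
      fps_nth ((binomial_lin a b * binomial_lin c d * binomial_sq e f) oo (fps_const w * fps_X)) n"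
    by (simp add: fps_compose_linear)
  also have "(binomial_lin a b * binomial_lin c d * binomial_sq e f) oo (fps_const w * fps_X) =
      binomial_lin a (b * w) * binomial_lin c (d * w) * binomial_sq e (f * w\<^sup>2)"
    by (simp add: fps_compose_mult_distrib binomial_lin_scale binomial_sq_scale)
  finally show ?thesis .
qed

text \<open>
  Substituting \<open>w v\<close> for \<open>z\<close> moves the singularity of the generating function at \<open>z = -w\<close> to \<open>v = -1\<close>
  and, if \<open>0 < |w| < 1\<close>, leaves the other factors with radius of convergence greater than 1.
\<close>

lemma calG_scaled:
  assumes "w \<noteq> 0"
  shows "w ^ n * calG n \<tau> \<rho> w =
    fps_nth (binomial_lin \<tau> (- (w\<^sup>2)) * binomial_lin (- \<tau>) 1 * binomial_sq (- \<rho>) (w\<^sup>2)) n"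
proof -
  have "(\<lambda>z. (1 + (- w) * z) powr \<tau> * (1 + (1 / w) * z) powr (- \<tau>) * (1 + 1 * z\<^sup>2) powr (- \<rho>)) has_fps_expansion
      binomial_lin \<tau> (- w) * binomial_lin (- \<tau>) (1 / w) * binomial_sq (- \<rho>) 1"
    by (intro has_fps_expansion_mult has_fps_expansion_binomial_lin has_fps_expansion_binomial_sq)
  hence "calG n \<tau> \<rho> w = fps_nth (binomial_lin \<tau> (- w) * binomial_lin (- \<tau>) (1 / w) * binomial_sq (- \<rho>) 1) n"
    unfolding calG_def by (subst fps_expansion_eqI) simp_all
  thus ?thesis
    using scaled_product_nth[of w n \<tau> "- w" "- \<tau>" "1 / w" "- \<rho>" 1] assms
    by (simp add: power2_eq_square)
qed

lemma calG_hat_scaled: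
  assumes "w \<noteq> 0"
  shows "w ^ n * calG_hat n \<tau> \<rho> w =
    fps_nth (binomial_lin \<tau> (w\<^sup>2) * binomial_lin (- \<tau>) 1 * binomial_sq (- \<rho>) (- (w\<^sup>2))) n"
proof -
  have "(\<lambda>z. (1 + w * z) powr \<tau> * (1 + (1 / w) * z) powr (- \<tau>) * (1 + (- 1) * z\<^sup>2) powr (- \<rho>)) has_fps_expansion
      binomial_lin \<tau> w * binomial_lin (- \<tau>) (1 / w) * binomial_sq (- \<rho>) (- 1)"
    by (intro has_fps_expansion_mult has_fps_expansion_binomial_lin has_fps_expansion_binomial_sq)
  hence "calG_hat n \<tau> \<rho> w = fps_nth (binomial_lin \<tau> w * binomial_lin (- \<tau>) (1 / w) * binomial_sq (- \<rho>) (- 1)) n"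
    unfolding calG_hat_def by (subst fps_expansion_eqI) simp_all
  thus ?thesis
    using scaled_product_nth[of w n \<tau> w "- \<tau>" "1 / w" "- \<rho>" "- 1"] assms
    by (simp add: power2_eq_square)
qed

lemma of_real_powr_half:
  assumes "Q > 0"
  shows "complex_of_real Q powr (of_nat n / 2) = of_real (sqrt Q) ^ n"
proof -
  have "complex_of_real Q powr (of_nat n / 2) = of_real (Q powr (real n / 2))"
    using assms powr_of_real[of Q "real n / 2"] by simp
  also have "Q powr (real n / 2) = sqrt Q ^ n"
    using assms powr_powr[of Q "1 / 2" "real n"] by (simp add: powr_half_sqrt powr_realpow)
  finally show ?thesis by simp
qed

text \<open>
  The two pairs of relations differ only in the sign of \<open>q\<close> and in the roles of the points \<open>x\<close> and
  \<open>1/x\<close>. Here \<open>P m\<close> and \<open>P' m\<close> stand for the functions of order \<open>-m\<close> at the two points,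
  \<open>V\<close> and \<open>V'\<close> for the factors \<open>((1 + y)/2)^\<nu>\<close> at these points, and \<open>X\<close> for \<open>x^(-\<nu>)\<close> or \<open>x^\<nu>\<close>.
\<close>

locale legendre_pair =
  fixes \<nu> q X V V' :: complex and Q :: real and P P' :: "complex \<Rightarrow> complex"
  assumes Q: "0 < Q" and q: "norm q < 1" and X: "X \<noteq> 0" "V = X * V'"
    and P: "\<And>s. P (s + \<nu>) = of_real Q powr ((s + \<nu>) / 2) * V * legendre_series \<nu> s q"
    and P': "\<And>s. P' (s + \<nu>) = of_real Q powr ((s + \<nu>) / 2) * V' * legendre_series \<nu> s (- q)"
begin

text \<open>
  The terms of both expansions are this multiple of the terms in the quadratic expansions of
  \<open>legendre_series\<close>.
\<close>

definition pair_factor where "pair_factor s = 2 powr s / of_real (sqrt pi) * of_real Q powr ((s + \<nu>) / 2) * V'"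

lemma two_powr_minus: "(2::complex) powr (- s) = 1 / 2 powr s"
  by (simp add: powr_minus divide_inverse)

lemma expansion:
  assumes g: "\<And>n. of_real (sqrt Q) ^ n * g n =
    fps_nth (binomial_lin \<nu> (- q) * binomial_lin (- \<nu>) 1 * binomial_sq (- \<nu>) q) n"
  shows "(\<lambda>n. pochhammer (\<mu> - \<nu>) n * g n * rGamma ((of_nat n + \<mu> - \<nu> + 1) / 2) / 2 ^ n
           * of_real Q powr ((of_nat n + \<mu> - \<nu>) / 4) * P' ((\<mu> + \<nu> + of_nat n) / 2))
      sums (P \<mu> / (of_real (sqrt pi) * 2 powr (\<nu> - \<mu>) * X))"
proof -
  define s where "s = \<mu> - \<nu>"
  have "(\<lambda>n. pair_factor s * (of_real (sqrt Q) ^ n * g n * (pochhammer s n * half_Gamma_quot (s + of_nat n) *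
            legendre_series \<nu> ((s + of_nat n) / 2) (- q)))) sums (pair_factor s * legendre_series \<nu> s q)"
    unfolding g by (intro sums_mult legendre_series_quadratic_expansion q)
  also have "pair_factor s * legendre_series \<nu> s q = P \<mu> / (of_real (sqrt pi) * 2 powr (\<nu> - \<mu>) * X)"
  proof -
    have "2 powr (\<nu> - \<mu>) = (1 / 2 powr s :: complex)"
      using two_powr_minus[of s] by (simp add: s_def)
    moreover have "P \<mu> = of_real Q powr ((s + \<nu>) / 2) * V * legendre_series \<nu> s q"
      using P[of s] by (simp add: s_def)
    ultimately show ?thesis
      using X by (simp add: pair_factor_def)
  qed
  also have "(\<lambda>n. pair_factor s * (of_real (sqrt Q) ^ n * g n * (pochhammer s n * half_Gamma_quot (s + of_nat n) *
            legendre_series \<nu> ((s + of_nat n) / 2) (- q)))) =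
      (\<lambda>n. pochhammer (\<mu> - \<nu>) n * g n * rGamma ((of_nat n + \<mu> - \<nu> + 1) / 2) / 2 ^ n
           * of_real Q powr ((of_nat n + \<mu> - \<nu>) / 4) * P' ((\<mu> + \<nu> + of_nat n) / 2))"
  proof
    fix n :: nat
    let ?L = "legendre_series \<nu> ((s + of_nat n) / 2) (- q)" and ?R = "rGamma ((of_nat n + \<mu> - \<nu> + 1) / 2)"
    have "(\<mu> + \<nu> + of_nat n) / 2 = (s + of_nat n) / 2 + \<nu>"
      by (simp add: s_def field_simps)
    hence P'n: "P' ((\<mu> + \<nu> + of_nat n) / 2) = of_real Q powr (((s + of_nat n) / 2 + \<nu>) / 2) * V' * ?L"
      by (simp only: P')
    have "(of_nat n + \<mu> - \<nu>) / 4 + ((s + of_nat n) / 2 + \<nu>) / 2 = (s + \<nu>) / 2 + of_nat n / 2"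
      by (simp add: s_def field_simps)
    hence pw: "of_real Q powr ((of_nat n + \<mu> - \<nu>) / 4) * of_real Q powr (((s + of_nat n) / 2 + \<nu>) / 2) =
        of_real Q powr ((s + \<nu>) / 2) * of_real (sqrt Q) ^ n"
      unfolding of_real_powr_half[OF Q, symmetric] powr_add [symmetric] by (rule arg_cong)
    have "- (s + of_nat n) = - s - of_nat n" by simp
    hence "(2::complex) powr (- (s + of_nat n)) = 1 / 2 powr s / 2 ^ n"
      by (simp only: powr_diff two_powr_minus) (simp add: powr_nat')
    moreover have "(s + of_nat n + 1) / 2 = (of_nat n + \<mu> - \<nu> + 1) / 2"
      by (simp add: s_def)
    ultimately have hg: "half_Gamma_quot (s + of_nat n) = of_real (sqrt pi) * (1 / 2 powr s / 2 ^ n) * ?R"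
      by (simp only: half_Gamma_quot_def)
    have "pair_factor s * (of_real (sqrt Q) ^ n * g n * (pochhammer s n * half_Gamma_quot (s + of_nat n) * ?L)) =
        (of_real Q powr ((s + \<nu>) / 2) * of_real (sqrt Q) ^ n) * V' * g n * pochhammer s n * (?R / 2 ^ n) * ?L"
      unfolding pair_factor_def hg by simp
    also have "\<dots> = pochhammer (\<mu> - \<nu>) n * g n * ?R / 2 ^ n * of_real Q powr ((of_nat n + \<mu> - \<nu>) / 4) *
        P' ((\<mu> + \<nu> + of_nat n) / 2)"
      unfolding pw [symmetric] P'n unfolding s_def by (simp only: mult_ac times_divide_eq_right times_divide_eq_left)
    finally show "pair_factor s * (of_real (sqrt Q) ^ n * g n * (pochhammer s n * half_Gamma_quot (s + of_nat n) * ?L)) =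
        pochhammer (\<mu> - \<nu>) n * g n * ?R / 2 ^ n * of_real Q powr ((of_nat n + \<mu> - \<nu>) / 4) *
        P' ((\<mu> + \<nu> + of_nat n) / 2)" .
  qed
  finally show ?thesis .
qed

lemma inverse_expansion:
  assumes \<nu>: "Re \<nu> > - 1 \<or> \<nu> - \<mu> \<in> \<nat>"
    and h: "\<And>n. of_real (sqrt Q) ^ n * h n =
      fps_nth (binomial_lin (- \<nu>) (- q) * binomial_lin \<nu> 1 * binomial_sq \<nu> q) n"
  shows "(\<lambda>n. pochhammer (\<mu> - \<nu>) n * h n / (of_real (sqrt pi) * 2 powr (\<nu> - \<mu>) * X) * P (\<mu> + of_nat n))
      sums (of_real Q powr ((\<mu> - \<nu>) / 4) * P' ((\<mu> + \<nu>) / 2) * rGamma ((\<mu> - \<nu> + 1) / 2))"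
proof -
  define s where "s = \<mu> - \<nu>"
  have "Re \<nu> > - 1 \<or> (\<exists>m. s = - of_nat m)"
    using \<nu> by (auto simp: s_def elim!: Nats_cases) (metis minus_diff_eq)
  hence "(\<lambda>n. pair_factor s * (of_real (sqrt Q) ^ n * h n * (pochhammer s n * legendre_series \<nu> (s + of_nat n) q)))
      sums (pair_factor s * (half_Gamma_quot s * legendre_series \<nu> (s / 2) (- q)))"
    unfolding h by (intro sums_mult legendre_series_quadratic_inverse q)
  also have "pair_factor s * (half_Gamma_quot s * legendre_series \<nu> (s / 2) (- q)) =
      of_real Q powr ((\<mu> - \<nu>) / 4) * P' ((\<mu> + \<nu>) / 2) * rGamma ((\<mu> - \<nu> + 1) / 2)"
  proof -
    have "(\<mu> + \<nu>) / 2 = s / 2 + \<nu>"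
      by (simp add: s_def field_simps)
    hence P'0: "P' ((\<mu> + \<nu>) / 2) = of_real Q powr ((s / 2 + \<nu>) / 2) * V' * legendre_series \<nu> (s / 2) (- q)"
      by (simp only: P')
    have "s / 4 + (s / 2 + \<nu>) / 2 = (s + \<nu>) / 2"
      by (simp add: field_simps)
    hence pw: "of_real Q powr (s / 4) * of_real Q powr ((s / 2 + \<nu>) / 2) = of_real Q powr ((s + \<nu>) / 2)"
      unfolding powr_add [symmetric] by (rule arg_cong)
    have "pair_factor s * (half_Gamma_quot s * legendre_series \<nu> (s / 2) (- q)) =
        of_real Q powr ((s + \<nu>) / 2) * V' * rGamma ((s + 1) / 2) * legendre_series \<nu> (s / 2) (- q)"
      unfolding pair_factor_def half_Gamma_quot_def two_powr_minus by simp
    thus ?thesis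
      unfolding P'0 s_def [symmetric] pw [symmetric] by (simp only: mult_ac)
  qed
  also have "(\<lambda>n. pair_factor s * (of_real (sqrt Q) ^ n * h n * (pochhammer s n * legendre_series \<nu> (s + of_nat n) q))) =
      (\<lambda>n. pochhammer (\<mu> - \<nu>) n * h n / (of_real (sqrt pi) * 2 powr (\<nu> - \<mu>) * X) * P (\<mu> + of_nat n))"
  proof
    fix n :: nat
    let ?L = "legendre_series \<nu> (s + of_nat n) q"
    have "\<mu> + of_nat n = s + of_nat n + \<nu>"
      by (simp add: s_def)
    hence Pn: "P (\<mu> + of_nat n) = of_real Q powr ((s + of_nat n + \<nu>) / 2) * V * ?L"
      by (simp only: P)
    have "(s + of_nat n + \<nu>) / 2 = (s + \<nu>) / 2 + of_nat n / 2"
      by (simp add: field_simps)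
    hence pw: "of_real Q powr ((s + of_nat n + \<nu>) / 2) = of_real Q powr ((s + \<nu>) / 2) * of_real (sqrt Q) ^ n"
      by (simp only: powr_add of_real_powr_half[OF Q])
    have "2 powr (\<nu> - \<mu>) = (1 / 2 powr s :: complex)"
      using two_powr_minus[of s] by (simp add: s_def)
    thus "pair_factor s * (of_real (sqrt Q) ^ n * h n * (pochhammer s n * ?L)) =
        pochhammer (\<mu> - \<nu>) n * h n / (of_real (sqrt pi) * 2 powr (\<nu> - \<mu>) * X) * P (\<mu> + of_nat n)"
      unfolding Pn pw pair_factor_def s_def [symmetric] using X by (simp add: mult_ac)
  qed
  finally show ?thesis .
qed

end

theorem theorem13:
  fixes x :: real and \<mu> \<nu> :: complex
  assumes "0 < x" and "x < 1"
  shows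
    "((\<lambda>n. pochhammer (\<mu> - \<nu>) n * calG n \<nu> \<nu> (complex_of_real (sqrt ((1 - x) / (1 + x))))
           * rGamma ((of_nat n + \<mu> - \<nu> + 1) / 2) / 2 ^ n
           * complex_of_real ((1 - x) / (1 + x)) powr ((of_nat n + \<mu> - \<nu>) / 4)
           * legendreP \<nu> (- ((\<mu> + \<nu> + of_nat n) / 2)) x)
      sums (legendreP \<nu> (- \<mu>) (1 / x)
            / (complex_of_real (sqrt pi) * 2 powr (\<nu> - \<mu>) * complex_of_real x powr (- \<nu>))))
   \<and> (Re \<nu> > - 1 \<or> \<nu> - \<mu> \<in> \<nat> \<longrightarrow>
      (\<lambda>n. pochhammer (\<mu> - \<nu>) n * calG n (- \<nu>) (- \<nu>) (complex_of_real (sqrt ((1 - x) / (1 + x))))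
           / (complex_of_real (sqrt pi) * 2 powr (\<nu> - \<mu>) * complex_of_real x powr (- \<nu>))
           * legendreP \<nu> (- \<mu> - of_nat n) (1 / x))
      sums (complex_of_real ((1 - x) / (1 + x)) powr ((\<mu> - \<nu>) / 4)
            * legendreP \<nu> (- ((\<mu> + \<nu>) / 2)) x * rGamma ((\<mu> - \<nu> + 1) / 2)))
   \<and> ((\<lambda>n. pochhammer (\<mu> - \<nu>) n * calG_hat n \<nu> \<nu> (complex_of_real (sqrt ((1 - x) / (1 + x))))
           * rGamma ((of_nat n + \<mu> - \<nu> + 1) / 2) / 2 ^ n
           * complex_of_real ((1 - x) / (1 + x)) powr ((of_nat n + \<mu> - \<nu>) / 4)
           * legendreP \<nu> (- ((\<mu> + \<nu> + of_nat n) / 2)) (1 / x))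
      sums (legendreP \<nu> (- \<mu>) x
            / (complex_of_real (sqrt pi) * 2 powr (\<nu> - \<mu>) * complex_of_real x powr \<nu>)))
   \<and> (Re \<nu> > - 1 \<or> \<nu> - \<mu> \<in> \<nat> \<longrightarrow>
      (\<lambda>n. pochhammer (\<mu> - \<nu>) n * calG_hat n (- \<nu>) (- \<nu>) (complex_of_real (sqrt ((1 - x) / (1 + x))))
           / (complex_of_real (sqrt pi) * 2 powr (\<nu> - \<mu>) * complex_of_real x powr \<nu>)
           * legendreP \<nu> (- \<mu> - of_nat n) x)
      sums (complex_of_real ((1 - x) / (1 + x)) powr ((\<mu> - \<nu>) / 4)
            * legendreP \<nu> (- ((\<mu> + \<nu>) / 2)) (1 / x) * rGamma ((\<mu> - \<nu> + 1) / 2)))"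
proof -
  define Q where "Q = (1 - x) / (1 + x)"
  define V where "V = of_real ((1 + x) / 2) powr \<nu>"
  define W where "W = of_real ((1 + 1 / x) / 2) powr \<nu>"
  have Q: "0 < Q" "Q < 1"
    using assms by (auto simp: Q_def)
  let ?w = "complex_of_real (sqrt Q)"
  have w: "?w \<noteq> 0" "?w\<^sup>2 = of_real Q"
    using Q by (auto simp flip: of_real_power)
  have neg: "- \<mu> - of_nat n = - (\<mu> + of_nat n)" for n
    by simp
  have Px: "legendreP \<nu> (- (s + \<nu>)) x = of_real Q powr ((s + \<nu>) / 2) * V * legendre_series \<nu> s (- of_real Q)" for s
  proof -
    have "\<bar>(1 - x) / (1 + x)\<bar> = Q" "(x - 1) / (x + 1) = - Q"
      using assms by (auto simp: Q_def field_simps)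
    thus ?thesis
      using legendreP_conv_series[of x "s + \<nu>" s \<nu>] assms by (simp only: V_def of_real_minus)
  qed
  have Pinv: "legendreP \<nu> (- (s + \<nu>)) (1 / x) = of_real Q powr ((s + \<nu>) / 2) * W * legendre_series \<nu> s (of_real Q)" for s
  proof -
    have "(1 - 1 / x) / (1 + 1 / x) = - Q" "(1 / x - 1) / (1 / x + 1) = Q"
      using assms by (auto simp: Q_def divide_simps)
    moreover from this have "\<bar>(1 - 1 / x) / (1 + 1 / x)\<bar> = Q"
      using Q by simp
    moreover have "1 / x > 0"
      using assms by simp
    ultimately show ?thesis
      using legendreP_conv_series[of "1 / x" "s + \<nu>" s \<nu>] by (simp only: W_def)
  qed
  have V: "V = of_real x powr \<nu> * W"
  proof -
    have "of_real x powr \<nu> * W = (of_real x * of_real ((1 + 1 / x) / 2)) powr \<nu>"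
      unfolding W_def using assms by (intro powr_times_real [symmetric]) auto
    also have "complex_of_real x * of_real ((1 + 1 / x) / 2) = of_real ((1 + x) / 2)"
      unfolding of_real_mult [symmetric] using assms by (simp add: field_simps)
    finally show ?thesis
      by (simp add: V_def)
  qed
  have xnz: "complex_of_real x powr \<nu> \<noteq> 0"
    using assms by simp
  \<comment> \<open>Expansions in Ferrers functions at \<open>x\<close>, and their inverses.\<close>
  interpret ferrers: legendre_pair \<nu> "of_real Q" "of_real x powr (- \<nu>)" W V Q
      "\<lambda>m. legendreP \<nu> (- m) (1 / x)" "\<lambda>m. legendreP \<nu> (- m) x"
  proof
    show "W = of_real x powr (- \<nu>) * V"
      using xnz by (simp add: V powr_minus)
  qed (use Q assms Px Pinv in auto)
  \<comment> \<open>Expansions in associated Legendre functions at \<open>1/x\<close>, and their inverses.\<close>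
  interpret assoc: legendre_pair \<nu> "- of_real Q" "of_real x powr \<nu>" V W Q
      "\<lambda>m. legendreP \<nu> (- m) x" "\<lambda>m. legendreP \<nu> (- m) (1 / x)"
    by unfold_locales (use Q xnz V Px Pinv in auto)
  have G: "?w ^ n * calG n \<tau> \<tau> ?w =
      fps_nth (binomial_lin \<tau> (- of_real Q) * binomial_lin (- \<tau>) 1 * binomial_sq (- \<tau>) (of_real Q)) n" for n \<tau>
    using calG_scaled[OF w(1), of n \<tau> \<tau>] unfolding w(2) .
  have G_hat: "?w ^ n * calG_hat n \<tau> \<tau> ?w =
      fps_nth (binomial_lin \<tau> (- (- of_real Q)) * binomial_lin (- \<tau>) 1 * binomial_sq (- \<tau>) (- of_real Q)) n" for n \<tau>
    using calG_hat_scaled[OF w(1), of n \<tau> \<tau>] unfolding w(2) by simp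
  have G_inv: "?w ^ n * calG n (- \<nu>) (- \<nu>) ?w =
      fps_nth (binomial_lin (- \<nu>) (- of_real Q) * binomial_lin \<nu> 1 * binomial_sq \<nu> (of_real Q)) n" for n
    using G[of n "- \<nu>"] by simp
  have G_hat_inv: "?w ^ n * calG_hat n (- \<nu>) (- \<nu>) ?w =
      fps_nth (binomial_lin (- \<nu>) (- (- of_real Q)) * binomial_lin \<nu> 1 * binomial_sq \<nu> (- of_real Q)) n" for n
    using G_hat[of n "- \<nu>"] by simp
  show ?thesis
    unfolding Q_def [symmetric] neg
    by (intro conjI impI ferrers.expansion ferrers.inverse_expansion assoc.expansion assoc.inverse_expansion
          G G_hat G_inv G_hat_inv)
qed

end
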